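(* Let $0\le l<u<\infty$, $\sigma>0$, $x\in[l,u]$, $\theta_0\in\mathbb{R}$ and $\rho>0$. Let $f:[l,u]\to\mathbb{R}$ be Lipschitz continuous on $[l,u]$ and not identically $0$ on $[l,u]$. Let $X=\{X_t\}_{t\ge0}$ be the solution of the reflected stochastic differential equation $$\mathrm{d}X_t=\theta_0 f(X_t)\,\mathrm{d}t+\sigma\,\mathrm{d}W_t+\mathrm{d}L_t-\mathrm{d}R_t,\qquad X_0=x,$$ with reflecting barriers $l$ and $u$. Let $\hat\theta_T$ be the maximum likelihood estimator of $\theta_0$ based on the continuous observation of $X$ on $[0,T]$, i.e. $\hat\theta_T=\arg\max_{\theta\in\Theta}\ell_T(\theta)$, where $\Theta=\{\theta\in\mathbb{R}:|\theta-\theta_0|\le\rho\}$ and $$\ell_T(\theta)=\frac1T\left(\frac{\theta}{\sigma^2}\int_0^T f(X_t)\big(\mathrm{d}X_t-\mathrm{d}L_t+\mathrm{d}R_t\big)-\frac{\theta^2}{2\sigma^2}\int_0^T f^2(X_t)\,\mathrm{d}t\right).$$ Then $\hat\theta_T\to\theta_0$ almost surely as $T\to\infty$.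
   Context: $(\Omega,\mathcal{F},\mathbb{P},\{\mathcal{F}_t\}_{t\ge0})$ is a filtered probability space carrying a one-dimensional standard $\{\mathcal{F}_t\}$-Brownian motion $W$. The reflected equation is understood as follows: $X$ is the unique strong solution, it is continuous and adapted with $X_t\in[l,u]$ for all $t\ge0$; $L$ and $R$ are the minimal continuous nondecreasing adapted processes with $L_0=R_0=0$ keeping $X$ in $[l,u]$, and they increase only when $X$ is at $l$ and at $u$ respectively: $\int_0^\infty I_{\{X_t>l\}}\,\mathrm{d}L_t=0$ and $\int_0^\infty I_{\{X_t<u\}}\,\mathrm{d}R_t=0$. The function $\ell_T$ is the normalized log-likelihood; when $\int_0^Tf^2(X_t)\,\mathrm{d}t>0$ it is strictly concave, so its maximizer over the compact interval $\Theta$ is unique; otherwise any choice of maximizer in $\Theta$ is allowed. *)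

theory Defs
  imports "HOL-Probability.Probability"
begin

(* Time runs over [0, \<infinity>); values of processes and of F at negative times are irrelevant
   everywhere below. No usual conditions (completeness, right-continuity) are imposed on F. *)

locale filtered_prob_space = prob_space M + filtration "space M" "\<lambda>t. F (max 0 t)"
  for M :: "'a measure" and F :: "real \<Rightarrow> 'a measure" +
  assumes subalg: "0 \<le> t \<Longrightarrow> subalgebra M (F t)"

definition adapted :: "(real \<Rightarrow> 'a measure) \<Rightarrow> (real \<Rightarrow> 'a \<Rightarrow> real) \<Rightarrow> bool" where
  "adapted F X \<longleftrightarrow> (\<forall>t\<ge>0. X t \<in> borel_measurable (F t))"

definition brownian_motion ::
  "'a measure \<Rightarrow> (real \<Rightarrow> 'a measure) \<Rightarrow> (real \<Rightarrow> 'a \<Rightarrow> real) \<Rightarrow> bool" where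
  "brownian_motion M F W \<longleftrightarrow>
     adapted F W \<and>
     (AE \<omega> in M. W 0 \<omega> = 0 \<and> continuous_on {0..} (\<lambda>t. W t \<omega>)) \<and>
     (\<forall>s t. 0 \<le> s \<and> s < t \<longrightarrow>
        distributed M lborel (\<lambda>\<omega>. W t \<omega> - W s \<omega>) (normal_density 0 (sqrt (t - s))) \<and>
        prob_space.indep_set M (sets (F s))
          {(\<lambda>\<omega>. W t \<omega> - W s \<omega>) -` B \<inter> space M | B. B \<in> sets borel})"

(* dX = b(X) dt + \<sigma> dW + dL - dR on [l,u], X_0 = x. For each path, interval_measure of
   the time-extended path of L (resp. R) is the Lebesgue-Stieltjes measure dL (resp. dR);
   the extension is constant on (-\<infinity>, 0], so dL and dR put no mass there. *)
definition reflected_sde_solution ::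
  "'a measure \<Rightarrow> (real \<Rightarrow> 'a measure) \<Rightarrow> (real \<Rightarrow> 'a \<Rightarrow> real) \<Rightarrow>
   (real \<Rightarrow> real) \<Rightarrow> real \<Rightarrow> real \<Rightarrow> real \<Rightarrow> real \<Rightarrow>
   (real \<Rightarrow> 'a \<Rightarrow> real) \<Rightarrow> (real \<Rightarrow> 'a \<Rightarrow> real) \<Rightarrow> (real \<Rightarrow> 'a \<Rightarrow> real) \<Rightarrow> bool" where
  "reflected_sde_solution M F W b \<sigma> l u x X L R \<longleftrightarrow>
     adapted F X \<and> adapted F L \<and> adapted F R \<and>
     (AE \<omega> in M.
        continuous_on {0..} (\<lambda>t. X t \<omega>) \<and> (\<forall>t\<ge>0. X t \<omega> \<in> {l..u}) \<and>
        continuous_on {0..} (\<lambda>t. L t \<omega>) \<and> mono_on {0..} (\<lambda>t. L t \<omega>) \<and> L 0 \<omega> = 0 \<and>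
        continuous_on {0..} (\<lambda>t. R t \<omega>) \<and> mono_on {0..} (\<lambda>t. R t \<omega>) \<and> R 0 \<omega> = 0 \<and>
        (\<forall>t\<ge>0. X t \<omega> = x + integral {0..t} (\<lambda>s. b (X s \<omega>)) + \<sigma> * W t \<omega> + L t \<omega> - R t \<omega>) \<and>
        (\<integral>\<^sup>+ t. indicator {t. 0 \<le> t \<and> X t \<omega> > l} t
           \<partial>interval_measure (\<lambda>t. L (max 0 t) \<omega>)) = 0 \<and>
        (\<integral>\<^sup>+ t. indicator {t. 0 \<le> t \<and> X t \<omega> < u} t
           \<partial>interval_measure (\<lambda>t. R (max 0 t) \<omega>)) = 0)"

(* Convergence in probability, uniformly on compact time intervals. The exceptional events are
   covered by measurable sets, since measure is 0 on non-measurable sets and a supremum over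
   uncountably many times need not be measurable. *)
definition ucp ::
  "'a measure \<Rightarrow> (nat \<Rightarrow> real \<Rightarrow> 'a \<Rightarrow> real) \<Rightarrow> (real \<Rightarrow> 'a \<Rightarrow> real) \<Rightarrow> bool" where
  "ucp M Z Y \<longleftrightarrow>
     (\<forall>T\<ge>0. \<forall>\<epsilon>>0. \<exists>A. (\<forall>n. A n \<in> sets M \<and>
          {\<omega> \<in> space M. \<exists>t\<in>{0..T}. \<bar>Z n t \<omega> - Y t \<omega>\<bar> > \<epsilon>} \<subseteq> A n) \<and>
        (\<lambda>n. measure M (A n)) \<longlonglongrightarrow> 0)"

(* (\<xi>0, [(a_1, b_1, \<xi>_1), ..., (a_k, b_k, \<xi>_k)]) encodes the simple predictable process
   \<xi>0 1_{0} + \<xi>_1 1_(a_1, b_1] + ... + \<xi>_k 1_(a_k, b_k]. *)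
type_synonym 'a simple = "('a \<Rightarrow> real) \<times> (real \<times> real \<times> ('a \<Rightarrow> real)) list"

definition simple_process :: "'a measure \<Rightarrow> (real \<Rightarrow> 'a measure) \<Rightarrow> 'a simple \<Rightarrow> bool" where
  "simple_process M F H \<longleftrightarrow>
     fst H \<in> borel_measurable (F 0) \<and> (\<exists>C. \<forall>\<omega>\<in>space M. \<bar>fst H \<omega>\<bar> \<le> C) \<and>
     (\<forall>(a, b, \<xi>) \<in> set (snd H). 0 \<le> a \<and> a \<le> b \<and>
        \<xi> \<in> borel_measurable (F a) \<and> (\<exists>C. \<forall>\<omega>\<in>space M. \<bar>\<xi> \<omega>\<bar> \<le> C))"

definition simple_eval :: "'a simple \<Rightarrow> real \<Rightarrow> 'a \<Rightarrow> real" where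
  "simple_eval H t \<omega> =
     fst H \<omega> * indicator {0} t + (\<Sum>(a, b, \<xi>)\<leftarrow>snd H. \<xi> \<omega> * indicator {a<..b} t)"

definition simple_integral :: "'a simple \<Rightarrow> (real \<Rightarrow> 'a \<Rightarrow> real) \<Rightarrow> real \<Rightarrow> 'a \<Rightarrow> real" where
  "simple_integral H Y t \<omega> = (\<Sum>(a, b, \<xi>)\<leftarrow>snd H. \<xi> \<omega> * (Y (min t b) \<omega> - Y (min t a) \<omega>))"

(* I is (a version of) the stochastic integral process \<integral>_0^t H_s dY_s, for a continuous
   adapted integrand H and a semimartingale integrator Y, i.e. the value at H of the
   ucp-continuous extension of the elementary integral. For such H simple approximations always
   exist (left-endpoint step functions), so I is unique up to indistinguishability. *)
definition is_stochastic_integral ::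
  "'a measure \<Rightarrow> (real \<Rightarrow> 'a measure) \<Rightarrow> (real \<Rightarrow> 'a \<Rightarrow> real) \<Rightarrow> (real \<Rightarrow> 'a \<Rightarrow> real) \<Rightarrow>
   (real \<Rightarrow> 'a \<Rightarrow> real) \<Rightarrow> bool" where
  "is_stochastic_integral M F H Y I \<longleftrightarrow>
     (\<exists>S. (\<forall>n. simple_process M F (S n)) \<and> ucp M (\<lambda>n. simple_eval (S n)) H) \<and>
     (\<forall>S. (\<forall>n. simple_process M F (S n)) \<and> ucp M (\<lambda>n. simple_eval (S n)) H \<longrightarrow>
        ucp M (\<lambda>n. simple_integral (S n) Y) I)"

(* J is the process \<integral>_0^T f(X_t) (dX_t - dL_t + dR_t). *)
definition log_likelihood ::
  "(real \<Rightarrow> real) \<Rightarrow> real \<Rightarrow> (real \<Rightarrow> 'a \<Rightarrow> real) \<Rightarrow> (real \<Rightarrow> 'a \<Rightarrow> real) \<Rightarrow>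
   real \<Rightarrow> 'a \<Rightarrow> real \<Rightarrow> real" where
  "log_likelihood f \<sigma> X J T \<omega> \<theta> =
     1 / T * (\<theta> / \<sigma>\<^sup>2 * J T \<omega>
       - \<theta>\<^sup>2 / (2 * \<sigma>\<^sup>2) * integral {0..T} (\<lambda>t. (f (X t \<omega>))\<^sup>2))"

end

theory Submission
  imports Defs
begin

text \<open>Put \<open>A T = \<integral>\<^sub>0\<^sup>T f(X)\<^sup>2\<close>. Since \<open>dX - dL + dR = \<theta>0 f(X) dt + \<sigma> dW\<close>, the unconstrained maximizer is
  \<open>J T / A T = \<theta>0 + \<sigma> N T / A T\<close> with the martingale \<open>N T = \<integral>\<^sub>0\<^sup>T f(X) dW\<close>, so it suffices that
  \<open>N T / T \<longlongrightarrow> 0\<close> and that \<open>A T\<close> grows at least linearly.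

  The first claim follows from the weak \<open>L\<^sup>2\<close> maximal inequality on the intervals \<open>[0, 2\<^sup>j]\<close> and
  Borel--Cantelli; the inequality is proved for the left-endpoint sums, which approximate the
  integral uniformly in probability.

  For the second, no ergodic theory is needed: cut time into blocks of equal length. Whatever
  happened before, with probability at least some \<open>p > 0\<close> the increments of \<open>W\<close> over the small steps
  of a block push the path first down across \<open>[l, u]\<close> and then up again, without oscillating within
  a step. Then \<open>X\<close> crosses a level \<open>c\<close> near which \<open>f\<close> does not vanish, and stays near \<open>c\<close> for a whole
  step. A Chernoff bound shows that a positive fraction of all blocks is of this kind.\<close>

section \<open>Brownian increments and discrete transforms\<close>

text \<open>Two features of the definitions shape the details. \<open>J\<close> is known only as a
  ucp limit, so no isometry, martingale property or path continuity of \<open>J\<close> is ever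
  invoked: drift and Brownian part are separated inside the approximating sums and estimated there.
  And \<open>brownian_motion\<close> gives independence of the past for one increment at a time,
  over a filtration without usual conditions. So running suprema are taken over dyadic times, where
  they are events of the raw filtration, and conditional bounds take the form of inequalities valid
  after intersecting with an arbitrary past event.

  Visiting the level \<open>c\<close> infinitely often would not suffice: the denominator must grow
  linearly against a numerator known only to be o(T), hence the counting bound with positive
  density. Pushes in both directions are needed since nothing is known about \<open>X\<close> at the
  start of a block; any excess is absorbed by a barrier. The level \<open>c\<close> is strictly
  inside the interval, where neither \<open>L\<close> nor \<open>R\<close> acts, so that near
  \<open>c\<close> only drift and \<open>W\<close> move the path.\<close>

lemma Int_stable_vimage_borel:
  "Int_stable {Z -` A \<inter> S |A. A \<in> sets borel}"
proof (rule Int_stableI)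
  fix a b assume "a \<in> {Z -` A \<inter> S |A. A \<in> sets borel}" "b \<in> {Z -` A \<inter> S |A. A \<in> sets borel}"
  then obtain A B where "A \<in> sets borel" "B \<in> sets borel" "a = Z -` A \<inter> S" "b = Z -` B \<inter> S"
    by blast
  then show "a \<inter> b \<in> {Z -` A \<inter> S |A. A \<in> sets borel}"
    by (intro CollectI exI[of _ "A \<inter> B"]) auto
qed

locale brownian_space = filtered_prob_space M F
  for M :: "'a measure" and F :: "real \<Rightarrow> 'a measure" +
  fixes W :: "real \<Rightarrow> 'a \<Rightarrow> real"
  assumes brownian: "brownian_motion M F W"
begin

lemma space_filtration: "0 \<le> t \<Longrightarrow> space (F t) = space M"
  using subalg[of t] by (simp add: subalgebra_def)

lemma sets_filtration_mono: "0 \<le> s \<Longrightarrow> s \<le> t \<Longrightarrow> sets (F s) \<subseteq> sets (F t)"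
  using sets_F_mono[of s t] by (simp add: max_def)

lemma sets_filtration_le: "0 \<le> t \<Longrightarrow> sets (F t) \<subseteq> sets M"
  using subalg[of t] by (simp add: subalgebra_def)

lemma measurable_filtration_mono:
  "0 \<le> s \<Longrightarrow> s \<le> t \<Longrightarrow> Z \<in> borel_measurable (F s) \<Longrightarrow> Z \<in> borel_measurable (F t)"
  using sets_filtration_mono[of s t] space_filtration[of s] space_filtration[of t]
  by (auto simp: measurable_def)

lemma measurable_filtration_M:
  "0 \<le> t \<Longrightarrow> Z \<in> borel_measurable (F t) \<Longrightarrow> Z \<in> borel_measurable M"
  using sets_filtration_le[of t] space_filtration[of t] by (auto simp: measurable_def)

lemma W_adapted: "0 \<le> s \<Longrightarrow> s \<le> t \<Longrightarrow> W s \<in> borel_measurable (F t)"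
  using brownian by (auto simp: brownian_motion_def adapted_def intro: measurable_filtration_mono)

lemma W_measurable: "0 \<le> t \<Longrightarrow> W t \<in> borel_measurable M"
  using W_adapted[of t t] measurable_filtration_M by auto

lemma W_continuous: "AE \<omega> in M. continuous_on {0..} (\<lambda>t. W t \<omega>)"
  using brownian by (auto simp: brownian_motion_def)

lemma increment_distributed:
  "0 \<le> s \<Longrightarrow> s < t \<Longrightarrow>
     distributed M lborel (\<lambda>\<omega>. W t \<omega> - W s \<omega>) (normal_density 0 (sqrt (t - s)))"
  using brownian by (auto simp: brownian_motion_def)

text \<open>\<open>indep_var\<close> speaks of generated sigma-algebras, the Brownian hypothesis of
  the bare family of preimages. Such a family is stable under intersection, so independence passes
  to what it generates.\<close>

lemma increment_indep:
  assumes "0 \<le> s" "s < t" and Z: "Z \<in> borel_measurable (F s)"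
  shows "indep_var borel Z borel (\<lambda>\<omega>. W t \<omega> - W s \<omega>)"
proof -
  let ?D = "\<lambda>\<omega>. W t \<omega> - W s \<omega>"
  have rvZ: "Z \<in> borel_measurable M" and rvD: "?D \<in> borel_measurable M"
    using assms measurable_filtration_M W_measurable by auto
  have ind: "indep_set (sets (F s)) {?D -` B \<inter> space M | B. B \<in> sets borel}"
    using brownian assms by (auto simp: brownian_motion_def)
  have "{Z -` A \<inter> space M |A. A \<in> sets borel} \<subseteq> sets (F s)"
    using measurable_sets[OF Z] space_filtration[OF \<open>0 \<le> s\<close>] by auto
  then have "indep_set {Z -` A \<inter> space M |A. A \<in> sets borel} {?D -` B \<inter> space M | B. B \<in> sets borel}"
    using ind unfolding indep_set_def
    by (elim indep_sets_mono) (auto split: bool.splits)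
  then have "indep_set (sigma_sets (space M) {Z -` A \<inter> space M |A. A \<in> sets borel})
     (sigma_sets (space M) {?D -` B \<inter> space M | B. B \<in> sets borel})"
    by (intro indep_set_sigma_sets Int_stable_vimage_borel)
  then show ?thesis
    unfolding indep_var_eq using rvZ rvD by simp
qed

lemma increment_moments:
  assumes "0 \<le> s" "s < t"
  shows "integrable M (\<lambda>\<omega>. W t \<omega> - W s \<omega>)" "(\<integral>\<omega>. W t \<omega> - W s \<omega> \<partial>M) = 0"
    and "integrable M (\<lambda>\<omega>. (W t \<omega> - W s \<omega>)\<^sup>2)" "(\<integral>\<omega>. (W t \<omega> - W s \<omega>)\<^sup>2 \<partial>M) = t - s"
proof -
  let ?D = "\<lambda>\<omega>. W t \<omega> - W s \<omega>"
  have pos: "0 < sqrt (t - s)" using assms by simp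
  note D = increment_distributed[OF assms]
  show E: "(\<integral>\<omega>. ?D \<omega> \<partial>M) = 0"
    using normal_distributed_expectation[OF pos D] .
  have "variance ?D = (sqrt (t - s))\<^sup>2"
    by (rule normal_distributed_variance[OF pos D])
  then show "(\<integral>\<omega>. (?D \<omega>)\<^sup>2 \<partial>M) = t - s"
    using assms unfolding E by simp
  have "integrable lborel (\<lambda>x. normal_density 0 (sqrt (t - s)) x * x\<^sup>2)"
    using integrable_normal_moment[OF pos, of 0 2] by simp
  then show sq: "integrable M (\<lambda>\<omega>. (?D \<omega>)\<^sup>2)"
    using distributed_integrable[OF D, of "\<lambda>x. x\<^sup>2"] by simp
  then show "integrable M ?D"
    by (rule square_integrable_imp_integrable[rotated]) (use assms W_measurable in auto)
qed

text \<open>The martingale properties of \<open>W\<close> and of its square minus time, tested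
  against a past variable \<open>Z\<close> instead of stated with conditional expectations:
  \<open>Z\<close> and the increment are independent, so expectations factorize.\<close>

lemma integral_times_increment:
  assumes "0 \<le> s" "s < t" "Z \<in> borel_measurable (F s)" "integrable M Z"
  shows "integrable M (\<lambda>\<omega>. Z \<omega> * (W t \<omega> - W s \<omega>))"
    and "(\<integral>\<omega>. Z \<omega> * (W t \<omega> - W s \<omega>) \<partial>M) = 0"
    and "integrable M (\<lambda>\<omega>. Z \<omega> * (W t \<omega> - W s \<omega>)\<^sup>2)"
    and "(\<integral>\<omega>. Z \<omega> * (W t \<omega> - W s \<omega>)\<^sup>2 \<partial>M) = (\<integral>\<omega>. Z \<omega> \<partial>M) * (t - s)"
proof -
  note mom = increment_moments[OF assms(1,2)]
  note ind = increment_indep[OF assms(1-3)]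
  have ind2: "indep_var borel Z borel (\<lambda>\<omega>. (W t \<omega> - W s \<omega>)\<^sup>2)"
    using indep_var_compose[OF ind, of "\<lambda>x. x" borel "\<lambda>x. x\<^sup>2" borel] by (simp add: comp_def)
  show "integrable M (\<lambda>\<omega>. Z \<omega> * (W t \<omega> - W s \<omega>))"
    using indep_var_integrable[OF ind assms(4) mom(1)] .
  show "(\<integral>\<omega>. Z \<omega> * (W t \<omega> - W s \<omega>) \<partial>M) = 0"
    using indep_var_lebesgue_integral[OF ind assms(4) mom(1)] mom(2) by simp
  show "integrable M (\<lambda>\<omega>. Z \<omega> * (W t \<omega> - W s \<omega>)\<^sup>2)"
    using indep_var_integrable[OF ind2 assms(4) mom(3)] .
  show "(\<integral>\<omega>. Z \<omega> * (W t \<omega> - W s \<omega>)\<^sup>2 \<partial>M) = (\<integral>\<omega>. Z \<omega> \<partial>M) * (t - s)"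
    using indep_var_lebesgue_integral[OF ind2 assms(4) mom(3)] mom(4) by simp
qed

section \<open>Martingale transforms of Brownian increments\<close>

definition transform :: "(nat \<Rightarrow> real) \<Rightarrow> (nat \<Rightarrow> 'a \<Rightarrow> real) \<Rightarrow> nat \<Rightarrow> 'a \<Rightarrow> real" where
  "transform \<tau> \<xi> n \<omega> = (\<Sum>k<n. \<xi> k \<omega> * (W (\<tau> (Suc k)) \<omega> - W (\<tau> k) \<omega>))"

lemma transform_measurable:
  assumes \<tau>: "strict_mono \<tau>" "0 \<le> \<tau> 0" and "n \<le> m"
    and \<xi>: "\<And>k. k < n \<Longrightarrow> \<xi> k \<in> borel_measurable (F (\<tau> k))"
  shows "transform \<tau> \<xi> n \<in> borel_measurable (F (\<tau> m))"
proof -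
  have pos: "0 \<le> \<tau> k" for k
    using \<tau> strict_mono_less_eq[OF \<tau>(1), of 0 k] by linarith
  have "\<xi> k \<in> borel_measurable (F (\<tau> m))" if "k < n" for k
    using \<xi>[OF that] pos[of k] strict_mono_less_eq[OF \<tau>(1), of k m] that \<open>n \<le> m\<close>
    by (intro measurable_filtration_mono[of "\<tau> k" "\<tau> m"]) auto
  moreover have "W (\<tau> k) \<in> borel_measurable (F (\<tau> m))" if "k \<le> n" for k
    using pos[of k] strict_mono_less_eq[OF \<tau>(1), of k m] that \<open>n \<le> m\<close> by (intro W_adapted) auto
  ultimately have "(\<lambda>\<omega>. \<Sum>k<n. \<xi> k \<omega> * (W (\<tau> (Suc k)) \<omega> - W (\<tau> k) \<omega>)) \<in> borel_measurable (F (\<tau> m))"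
    by (intro borel_measurable_sum borel_measurable_times borel_measurable_diff) auto
  then show ?thesis by (simp add: transform_def[abs_def])
qed

text \<open>Expand the square at the last step. The cross term is a factor known at
  \<open>\<tau> n\<close> times a centred increment and integrates to 0; the last square contributes
  its variance. Boundedness of \<open>\<xi> k\<close> makes both products integrable.\<close>

lemma transform_isometry:
  assumes \<tau>: "strict_mono \<tau>" "0 \<le> \<tau> 0"
    and \<xi>: "\<And>k. k < n \<Longrightarrow> \<xi> k \<in> borel_measurable (F (\<tau> k))"
    and bd: "\<And>k \<omega>. k < n \<Longrightarrow> \<omega> \<in> space M \<Longrightarrow> \<bar>\<xi> k \<omega>\<bar> \<le> C"
  shows "integrable M (\<lambda>\<omega>. (transform \<tau> \<xi> n \<omega>)\<^sup>2) \<and>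
    (\<integral>\<omega>. (transform \<tau> \<xi> n \<omega>)\<^sup>2 \<partial>M) = (\<Sum>k<n. (\<integral>\<omega>. (\<xi> k \<omega>)\<^sup>2 \<partial>M) * (\<tau> (Suc k) - \<tau> k))"
  using \<xi> bd
proof (induction n)
  case 0
  then show ?case by (simp add: transform_def)
next
  case (Suc n)
  let ?S = "transform \<tau> \<xi> n" and ?D = "\<lambda>\<omega>. W (\<tau> (Suc n)) \<omega> - W (\<tau> n) \<omega>"
  have pos: "0 \<le> \<tau> n"
    using \<tau> strict_mono_less_eq[OF \<tau>(1), of 0 n] by linarith
  have less: "\<tau> n < \<tau> (Suc n)" using \<tau> by (simp add: strict_mono_Suc_iff)
  have IH: "integrable M (\<lambda>\<omega>. (?S \<omega>)\<^sup>2)"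
    "(\<integral>\<omega>. (?S \<omega>)\<^sup>2 \<partial>M) = (\<Sum>k<n. (\<integral>\<omega>. (\<xi> k \<omega>)\<^sup>2 \<partial>M) * (\<tau> (Suc k) - \<tau> k))"
    using Suc by auto
  have Smeas: "?S \<in> borel_measurable (F (\<tau> n))"
    using Suc.prems by (intro transform_measurable[OF \<tau>]) auto
  have Xmeas: "\<xi> n \<in> borel_measurable (F (\<tau> n))" using Suc.prems by simp
  note Smeas' [measurable] = measurable_filtration_M[OF pos Smeas]
  note Xmeas' [measurable] = measurable_filtration_M[OF pos Xmeas]
  have Sint: "integrable M ?S"
    by (rule square_integrable_imp_integrable) (auto intro: IH)
  have SXint: "integrable M (\<lambda>\<omega>. 2 * (?S \<omega> * \<xi> n \<omega>))"
  proof (rule Bochner_Integration.integrable_bound[OF integrable_mult_right[OF integrable_abs[OF Sint], of "2 * \<bar>C\<bar>"]])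
    show "AE \<omega> in M. norm (2 * (?S \<omega> * \<xi> n \<omega>)) \<le> norm (2 * \<bar>C\<bar> * \<bar>?S \<omega>\<bar>)"
    proof (rule AE_I2)
      fix \<omega> assume "\<omega> \<in> space M"
      then have "\<bar>\<xi> n \<omega>\<bar> \<le> \<bar>C\<bar>" using Suc.prems(2)[of n \<omega>] by auto
      then have "\<bar>?S \<omega>\<bar> * \<bar>\<xi> n \<omega>\<bar> \<le> \<bar>?S \<omega>\<bar> * \<bar>C\<bar>" by (intro mult_left_mono) auto
      then show "norm (2 * (?S \<omega> * \<xi> n \<omega>)) \<le> norm (2 * \<bar>C\<bar> * \<bar>?S \<omega>\<bar>)"
        by (simp add: abs_mult mult_ac)
    qed
  qed simp
  have X2int: "integrable M (\<lambda>\<omega>. (\<xi> n \<omega>)\<^sup>2)"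
  proof (rule Bochner_Integration.integrable_bound[OF integrable_const[of "C\<^sup>2"]])
    show "AE \<omega> in M. norm ((\<xi> n \<omega>)\<^sup>2) \<le> norm (C\<^sup>2)"
      using Suc.prems(2)[of n] by (intro AE_I2) (auto simp: abs_le_square_iff[symmetric] intro: order_trans[OF _ abs_ge_self])
  qed simp
  have X2meas: "(\<lambda>\<omega>. (\<xi> n \<omega>)\<^sup>2) \<in> borel_measurable (F (\<tau> n))" "(\<lambda>\<omega>. 2 * (?S \<omega> * \<xi> n \<omega>)) \<in> borel_measurable (F (\<tau> n))"
    using Xmeas Smeas by measurable
  note cross = integral_times_increment[OF pos less X2meas(2) SXint]
  note diag = integral_times_increment[OF pos less X2meas(1) X2int]
  have eq: "(transform \<tau> \<xi> (Suc n) \<omega>)\<^sup>2 =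
      (?S \<omega>)\<^sup>2 + (2 * (?S \<omega> * \<xi> n \<omega>) * ?D \<omega> + (\<xi> n \<omega>)\<^sup>2 * (?D \<omega>)\<^sup>2)" for \<omega>
    by (simp add: transform_def power2_eq_square algebra_simps)
  show ?case
    unfolding eq using IH cross(1,2) diag(3,4) by simp
qed

text \<open>The weak maximal inequality comes from the isometry for the transform stopped at the first
  exceedance of \<open>\<kappa>\<close>: stopping only multiplies \<open>\<xi> k\<close> by an indicator of an event known at time \<open>\<tau> k\<close>.\<close>

lemma transform_maximal:
  assumes \<tau>: "strict_mono \<tau>" "0 \<le> \<tau> 0"
    and \<xi>: "\<And>k. k < n \<Longrightarrow> \<xi> k \<in> borel_measurable (F (\<tau> k))"
    and bd: "\<And>k \<omega>. k < n \<Longrightarrow> \<omega> \<in> space M \<Longrightarrow> \<bar>\<xi> k \<omega>\<bar> \<le> C"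
    and "0 < \<kappa>"
  shows "{\<omega> \<in> space M. \<exists>j\<le>n. \<bar>transform \<tau> \<xi> j \<omega>\<bar> > \<kappa>} \<in> sets (F (\<tau> n))"
    and "measure M {\<omega> \<in> space M. \<exists>j\<le>n. \<bar>transform \<tau> \<xi> j \<omega>\<bar> > \<kappa>}
      \<le> (\<Sum>k<n. (\<integral>\<omega>. (\<xi> k \<omega>)\<^sup>2 \<partial>M) * (\<tau> (Suc k) - \<tau> k)) / \<kappa>\<^sup>2"
proof -
  let ?S = "transform \<tau> \<xi>"
  have pos: "0 \<le> \<tau> k" for k
    using \<tau> strict_mono_less_eq[OF \<tau>(1), of 0 k] by linarith
  have inc: "0 \<le> \<tau> (Suc k) - \<tau> k" for k
    using strict_mono_less_eq[OF \<tau>(1), of k "Suc k"] by simp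
  have Smeas: "?S i \<in> borel_measurable (F (\<tau> k))" if "i \<le> k" "i \<le> n" for i k
    using that by (intro transform_measurable[OF \<tau>] \<xi>) auto
  define E where "E k = {\<omega> \<in> space M. \<forall>i\<le>k. \<bar>?S i \<omega>\<bar> \<le> \<kappa>}" for k
  have E_sets: "E k \<in> sets (F (\<tau> k))" if "k \<le> n" for k
  proof -
    have "{\<omega> \<in> space (F (\<tau> k)). \<bar>?S i \<omega>\<bar> \<le> \<kappa>} \<in> sets (F (\<tau> k))" if "i \<le> k" for i
      using Smeas[of i k] that \<open>k \<le> n\<close> by (intro borel_measurable_le) auto
    then have "{\<omega> \<in> space (F (\<tau> k)). \<forall>i\<in>{..k}. \<bar>?S i \<omega>\<bar> \<le> \<kappa>} \<in> sets (F (\<tau> k))"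
      by (intro sets.sets_Collect_finite_All') auto
    then show ?thesis
      unfolding E_def space_filtration[OF pos] Ball_def atMost_iff .
  qed
  have eqE: "{\<omega> \<in> space M. \<exists>j\<le>n. \<bar>?S j \<omega>\<bar> > \<kappa>} = space M - E n"
    by (auto simp: E_def not_le)
  show ev: "{\<omega> \<in> space M. \<exists>j\<le>n. \<bar>?S j \<omega>\<bar> > \<kappa>} \<in> sets (F (\<tau> n))"
    unfolding eqE using sets.compl_sets[OF E_sets[of n]] by (simp add: space_filtration[OF pos])
  \<comment> \<open>\<open>E k\<close> looks at sums up to index \<open>k\<close>, so the increment
    that first carries the sum beyond \<open>\<kappa>\<close> is kept and all later ones are
    dropped: the stopped sum ends at that first value.\<close>
  define \<zeta> where "\<zeta> k \<omega> = indicator (E k) \<omega> * \<xi> k \<omega>" for k \<omega>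
  have \<zeta>_meas: "\<zeta> k \<in> borel_measurable (F (\<tau> k))" if "k < n" for k
    unfolding \<zeta>_def[abs_def] using E_sets[of k] \<xi>[OF that] that
    by (intro borel_measurable_times borel_measurable_indicator) auto
  have \<zeta>_le: "\<bar>\<zeta> k \<omega>\<bar> \<le> \<bar>\<xi> k \<omega>\<bar>" for k \<omega>
    by (auto simp: \<zeta>_def indicator_def)
  have \<zeta>_bd: "\<bar>\<zeta> k \<omega>\<bar> \<le> C" if "k < n" "\<omega> \<in> space M" for k \<omega>
    using bd[OF that] \<zeta>_le[of k \<omega>] by linarith
  have iso: "integrable M (\<lambda>\<omega>. (transform \<tau> \<zeta> n \<omega>)\<^sup>2)"
    "(\<integral>\<omega>. (transform \<tau> \<zeta> n \<omega>)\<^sup>2 \<partial>M) = (\<Sum>k<n. (\<integral>\<omega>. (\<zeta> k \<omega>)\<^sup>2 \<partial>M) * (\<tau> (Suc k) - \<tau> k))"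
    using transform_isometry[OF \<tau>, of n \<zeta> C] \<zeta>_meas \<zeta>_bd by auto
  have exceed: "\<bar>transform \<tau> \<zeta> n \<omega>\<bar> \<ge> \<kappa>" if \<omega>: "\<omega> \<in> space M" "\<exists>j\<le>n. \<bar>?S j \<omega>\<bar> > \<kappa>" for \<omega>
  proof -
    define j where "j = (LEAST j. \<bar>?S j \<omega>\<bar> > \<kappa>)"
    have j: "\<bar>?S j \<omega>\<bar> > \<kappa>" "j \<le> n"
      using \<omega>(2) LeastI_ex[of "\<lambda>j. \<bar>?S j \<omega>\<bar> > \<kappa>"] Least_le[of "\<lambda>j. \<bar>?S j \<omega>\<bar> > \<kappa>"]
      unfolding j_def by (auto intro: order_trans)
    have before: "\<bar>?S i \<omega>\<bar> \<le> \<kappa>" if "i < j" for i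
      using not_less_Least[of i "\<lambda>j. \<bar>?S j \<omega>\<bar> > \<kappa>"] that unfolding j_def by auto
    have \<zeta>1: "\<zeta> k \<omega> = \<xi> k \<omega>" if "k < j" for k
      using before that \<omega>(1) by (auto simp: \<zeta>_def E_def)
    have \<zeta>2: "\<zeta> k \<omega> = 0" if "j \<le> k" for k
      using that j(1) by (auto simp: \<zeta>_def E_def indicator_def not_le)
    have "transform \<tau> \<zeta> n \<omega> = (\<Sum>k<j. \<zeta> k \<omega> * (W (\<tau> (Suc k)) \<omega> - W (\<tau> k) \<omega>))"
      unfolding transform_def using \<open>j \<le> n\<close> \<zeta>2 by (intro sum.mono_neutral_right) auto
    also have "\<dots> = ?S j \<omega>"
      unfolding transform_def by (intro sum.cong) (auto simp: \<zeta>1)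
    finally show ?thesis using j(1) by simp
  qed
  have \<zeta>2int: "(\<integral>\<omega>. (\<zeta> k \<omega>)\<^sup>2 \<partial>M) \<le> (\<integral>\<omega>. (\<xi> k \<omega>)\<^sup>2 \<partial>M)" if "k < n" for k
  proof (rule integral_mono')
    have [measurable]: "\<xi> k \<in> borel_measurable M"
      using \<xi>[OF that] pos measurable_filtration_M by blast
    show "integrable M (\<lambda>\<omega>. (\<xi> k \<omega>)\<^sup>2)"
      using bd[OF that]
      by (intro Bochner_Integration.integrable_bound[OF integrable_const[of "C\<^sup>2"]])
         (auto simp: abs_le_square_iff[symmetric] intro: order_trans[OF _ abs_ge_self])
  qed (use \<zeta>_le in \<open>auto simp: abs_le_square_iff[symmetric]\<close>)
  have "measure M {\<omega> \<in> space M. \<exists>j\<le>n. \<bar>?S j \<omega>\<bar> > \<kappa>} \<le> measure M {\<omega> \<in> space M. (transform \<tau> \<zeta> n \<omega>)\<^sup>2 \<ge> \<kappa>\<^sup>2}"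
  proof (rule finite_measure_mono)
    show "{\<omega> \<in> space M. \<exists>j\<le>n. \<bar>?S j \<omega>\<bar> > \<kappa>} \<subseteq> {\<omega> \<in> space M. (transform \<tau> \<zeta> n \<omega>)\<^sup>2 \<ge> \<kappa>\<^sup>2}"
      using exceed \<open>0 < \<kappa>\<close> by (auto simp: abs_le_square_iff[symmetric])
    have "transform \<tau> \<zeta> n \<in> borel_measurable M"
      by (rule measurable_filtration_M[OF pos transform_measurable[OF \<tau> order_refl \<zeta>_meas]])
    then show "{\<omega> \<in> space M. (transform \<tau> \<zeta> n \<omega>)\<^sup>2 \<ge> \<kappa>\<^sup>2} \<in> events" by measurable
  qed
  also have "\<dots> \<le> (\<integral>\<omega>. (transform \<tau> \<zeta> n \<omega>)\<^sup>2 \<partial>M) / \<kappa>\<^sup>2"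
    using iso \<open>0 < \<kappa>\<close> by (intro integral_Markov_inequality_measure[where A="{}"]) auto
  also have "(\<integral>\<omega>. (transform \<tau> \<zeta> n \<omega>)\<^sup>2 \<partial>M) = (\<Sum>k<n. (\<integral>\<omega>. (\<zeta> k \<omega>)\<^sup>2 \<partial>M) * (\<tau> (Suc k) - \<tau> k))"
    using iso by simp
  also have "\<dots> \<le> (\<Sum>k<n. (\<integral>\<omega>. (\<xi> k \<omega>)\<^sup>2 \<partial>M) * (\<tau> (Suc k) - \<tau> k))"
    by (intro sum_mono mult_right_mono \<zeta>2int inc) auto
  finally show "measure M {\<omega> \<in> space M. \<exists>j\<le>n. \<bar>?S j \<omega>\<bar> > \<kappa>}
      \<le> (\<Sum>k<n. (\<integral>\<omega>. (\<xi> k \<omega>)\<^sup>2 \<partial>M) * (\<tau> (Suc k) - \<tau> k)) / \<kappa>\<^sup>2"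
    using \<open>0 < \<kappa>\<close> by (simp add: divide_right_mono)
qed

end

section \<open>A maximal inequality in continuous time\<close>

lemma dyadic_floor_le: "0 \<le> a \<Longrightarrow> real (nat \<lfloor>a * 2 ^ m\<rfloor>) / 2 ^ m \<le> a"
  by (simp add: divide_le_eq)

lemma dyadic_floor_tendsto:
  assumes "0 \<le> a"
  shows "(\<lambda>m. real (nat \<lfloor>a * 2 ^ m\<rfloor>) / 2 ^ m) \<longlonglongrightarrow> a"
proof (rule real_tendsto_sandwich)
  have "(\<lambda>m. a - (1 / 2) ^ m) \<longlonglongrightarrow> a - 0"
    by (intro tendsto_intros LIMSEQ_realpow_zero) auto
  then show "(\<lambda>m. a - (1 / 2) ^ m) \<longlonglongrightarrow> a" by simp
  show "\<forall>\<^sub>F m in sequentially. a - (1 / 2) ^ m \<le> real (nat \<lfloor>a * 2 ^ m\<rfloor>) / 2 ^ m"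
  proof (intro always_eventually allI)
    fix m
    have "a * 2 ^ m - 1 \<le> real (nat \<lfloor>a * 2 ^ m\<rfloor>)" by linarith
    then have "(a * 2 ^ m - 1) / 2 ^ m \<le> real (nat \<lfloor>a * 2 ^ m\<rfloor>) / 2 ^ m"
      by (intro divide_right_mono) auto
    then show "a - (1 / 2) ^ m \<le> real (nat \<lfloor>a * 2 ^ m\<rfloor>) / 2 ^ m"
      by (simp add: diff_divide_distrib power_one_over)
  qed
  show "\<forall>\<^sub>F m in sequentially. real (nat \<lfloor>a * 2 ^ m\<rfloor>) / 2 ^ m \<le> a"
    by (intro always_eventually allI dyadic_floor_le assms)
qed auto

context brownian_space
begin

definition step_integral ::
  "real \<Rightarrow> real \<Rightarrow> nat \<Rightarrow> (nat \<Rightarrow> 'a \<Rightarrow> real) \<Rightarrow> real \<Rightarrow> 'a \<Rightarrow> real" where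
  "step_integral s h K \<xi> t \<omega> =
     (\<Sum>k<K. \<xi> k \<omega> * (W (min t (s + real (Suc k) * h)) \<omega> - W (min t (s + real k * h)) \<omega>))"

text \<open>Splitting every cell into \<open>r\<close> parts does not change the integral: each
  coarse increment telescopes, and fine cell \<open>i\<close> inherits the coefficient of its coarse
  cell \<open>i div r\<close>. Cells from index \<open>j\<close> on vanish because both of their
  ends are capped.\<close>

lemma step_integral_grid:
  assumes "0 < h" "0 < r" "j \<le> K * r"
  shows "step_integral s h K \<xi> (s + real j * (h / real r)) \<omega> =
    transform (\<lambda>i. s + real i * (h / real r)) (\<lambda>i. \<xi> (i div r)) j \<omega>"
proof -
  let ?h = "h / real r" and ?t = "s + real j * (h / real r)"
  define V where "V i = W (min ?t (s + real i * ?h)) \<omega>" for i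
  have V: "W (min ?t (s + real k * h)) \<omega> = V (k * r)" for k
    using \<open>0 < r\<close> by (simp add: V_def)
  have tele: "V (Suc k * r) - V (k * r) = (\<Sum>i = k * r..<k * r + r. V (Suc i) - V i)" for k
    by (subst sum_Suc_diff') (auto simp: add.commute)
  have "step_integral s h K \<xi> ?t \<omega> = (\<Sum>k<K. \<xi> k \<omega> * (V (Suc k * r) - V (k * r)))"
    unfolding step_integral_def V ..
  also have "\<dots> = (\<Sum>k<K. \<Sum>i = k * r..<k * r + r. \<xi> (i div r) \<omega> * (V (Suc i) - V i))"
    unfolding tele sum_distrib_left
  proof (intro sum.cong refl)
    fix k i assume "i \<in> {k * r..<k * r + r}"
    then have "i div r = k"
      by (intro div_nat_eqI) (auto simp: mult.commute)
    then show "\<xi> k \<omega> * (V (Suc i) - V i) = \<xi> (i div r) \<omega> * (V (Suc i) - V i)" by simp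
  qed
  also have "\<dots> = (\<Sum>i<K * r. \<xi> (i div r) \<omega> * (V (Suc i) - V i))"
    by (rule sum.nat_group)
  also have "\<dots> = (\<Sum>i<j. \<xi> (i div r) \<omega> * (V (Suc i) - V i))"
  proof (rule sum.mono_neutral_right)
    have "V (Suc i) = V i" if "j \<le> i" for i
    proof -
      have "real j * ?h \<le> real i * ?h" "real j * ?h \<le> real (Suc i) * ?h"
        using that \<open>0 < h\<close> by (intro mult_right_mono; simp)+
      then show ?thesis unfolding V_def by (simp add: min_def)
    qed
    then show "\<forall>i\<in>{..<K * r} - {..<j}. \<xi> (i div r) \<omega> * (V (Suc i) - V i) = 0"
      by auto
  qed (use assms in auto)
  also have "\<dots> = transform (\<lambda>i. s + real i * ?h) (\<lambda>i. \<xi> (i div r)) j \<omega>"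
    unfolding transform_def
  proof (intro sum.cong refl)
    fix i assume "i \<in> {..<j}"
    then have "real i * ?h \<le> real j * ?h" "real (Suc i) * ?h \<le> real j * ?h"
      using \<open>0 < h\<close> by (intro mult_right_mono; simp)+
    then have "min ?t (s + real i * ?h) = s + real i * ?h"
      "min ?t (s + real (Suc i) * ?h) = s + real (Suc i) * ?h" by auto
    then show "\<xi> (i div r) \<omega> * (V (Suc i) - V i) = \<xi> (i div r) \<omega> *
        (W (s + real (Suc i) * ?h) \<omega> - W (s + real i * ?h) \<omega>)"
      unfolding V_def by (simp only:)
  qed
  finally show ?thesis .
qed

text \<open>Only the dyadic refinements of the grid are inspected, a countable set of times, so that
  this is an event of the uncompleted filtration. For continuous paths nothing is lost, by
  \<open>exceedanceI\<close>.\<close>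

definition exceedance ::
  "real \<Rightarrow> real \<Rightarrow> nat \<Rightarrow> (nat \<Rightarrow> 'a \<Rightarrow> real) \<Rightarrow> real \<Rightarrow> 'a set" where
  "exceedance s h K \<xi> \<kappa> =
     {\<omega> \<in> space M. \<exists>m. \<exists>j\<le>K * 2 ^ m. \<bar>step_integral s h K \<xi> (s + real j * (h / 2 ^ m)) \<omega>\<bar> > \<kappa>}"

text \<open>The inequality is strict, so by continuity it persists at dyadic times close to
  \<open>t\<close> from the left.\<close>

lemma exceedanceI:
  assumes "\<omega> \<in> space M" and cont: "continuous_on {0..} (\<lambda>t. W t \<omega>)"
    and "0 \<le> s" "0 < h" "s \<le> t" "t \<le> s + real K * h" "\<bar>step_integral s h K \<xi> t \<omega>\<bar> > \<kappa>"
  shows "\<omega> \<in> exceedance s h K \<xi> \<kappa>"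
proof -
  let ?Z = "\<lambda>t. step_integral s h K \<xi> t \<omega>"
  have Wcont: "continuous_on {s..} (\<lambda>t. W (min t c) \<omega>)" if "0 \<le> c" for c
    using that \<open>0 \<le> s\<close>
    by (intro continuous_on_compose2[OF cont, of "{s..}" "\<lambda>t. min t c"] continuous_intros) auto
  have Zcont: "continuous_on {s..} ?Z"
    unfolding step_integral_def
    using \<open>0 \<le> s\<close> \<open>0 < h\<close> by (intro continuous_intros Wcont) auto
  define j where "j m = nat \<lfloor>(t - s) / h * 2 ^ m\<rfloor>" for m :: nat
  have a0: "0 \<le> (t - s) / h" and aK: "(t - s) / h \<le> real K"
    using assms by (auto simp: field_simps)
  have jK: "j m \<le> K * 2 ^ m" for m
  proof -
    have "real (j m) / 2 ^ m \<le> real K"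
      using dyadic_floor_le[OF a0, of m] aK unfolding j_def by simp
    then have "real (j m) \<le> real (K * 2 ^ m)" by (simp add: field_simps)
    then show ?thesis by linarith
  qed
  have "(\<lambda>m. s + real (j m) / 2 ^ m * h) \<longlonglongrightarrow> s + (t - s) / h * h"
    unfolding j_def by (intro tendsto_intros dyadic_floor_tendsto a0)
  then have lim: "(\<lambda>m. s + real (j m) * (h / 2 ^ m)) \<longlonglongrightarrow> t"
    using \<open>0 < h\<close> by simp
  have "(\<lambda>m. ?Z (s + real (j m) * (h / 2 ^ m))) \<longlonglongrightarrow> ?Z t"
    using continuous_on_tendsto_compose[OF Zcont lim] assms by simp
  then have "(\<lambda>m. \<bar>?Z (s + real (j m) * (h / 2 ^ m))\<bar>) \<longlonglongrightarrow> \<bar>?Z t\<bar>"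
    by (rule tendsto_rabs)
  then have "\<forall>\<^sub>F m in sequentially. \<bar>?Z (s + real (j m) * (h / 2 ^ m))\<bar> > \<kappa>"
    using assms by (intro order_tendstoD)
  then obtain m where "\<bar>?Z (s + real (j m) * (h / 2 ^ m))\<bar> > \<kappa>"
    by (auto dest: eventually_happens)
  then show ?thesis
    using jK[of m] \<open>\<omega> \<in> space M\<close> unfolding exceedance_def by blast
qed

text \<open>The discrete bound does not depend on the refinement level, since splitting cells leaves
  the weighted sum of second moments unchanged. The refined events increase, so the bound survives
  the limit.\<close>

lemma exceedance_bound:
  assumes "0 \<le> s" "0 < h" "0 < \<kappa>"
    and \<xi>: "\<And>k. k < K \<Longrightarrow> \<xi> k \<in> borel_measurable (F (s + real k * h))"
    and bd: "\<And>k \<omega>. k < K \<Longrightarrow> \<omega> \<in> space M \<Longrightarrow> \<bar>\<xi> k \<omega>\<bar> \<le> C"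
  shows "exceedance s h K \<xi> \<kappa> \<in> sets (F (s + real K * h))"
    and "measure M (exceedance s h K \<xi> \<kappa>) \<le> h * (\<Sum>k<K. \<integral>\<omega>. (\<xi> k \<omega>)\<^sup>2 \<partial>M) / \<kappa>\<^sup>2"
proof -
  let ?Z = "step_integral s h K \<xi>"
  define Q where "Q m = {\<omega> \<in> space M. \<exists>j\<le>K * 2 ^ m. \<bar>?Z (s + real j * (h / 2 ^ m)) \<omega>\<bar> > \<kappa>}" for m :: nat
  have eq: "exceedance s h K \<xi> \<kappa> = (\<Union>m. Q m)"
    by (auto simp: exceedance_def Q_def)
  have Q: "Q m \<in> sets (F (s + real K * h)) \<and> measure M (Q m) \<le> h * (\<Sum>k<K. \<integral>\<omega>. (\<xi> k \<omega>)\<^sup>2 \<partial>M) / \<kappa>\<^sup>2" for m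
  proof -
    define r where "r = (2 :: nat) ^ m"
    have r: "0 < r" by (simp add: r_def)
    let ?\<tau> = "\<lambda>i. s + real i * (h / real r)"
    have \<tau>: "strict_mono ?\<tau>" "0 \<le> ?\<tau> 0"
      using r assms by (auto simp: strict_mono_def divide_strict_right_mono)
    have Q_eq: "Q m = {\<omega> \<in> space M. \<exists>j\<le>K * r. \<bar>transform ?\<tau> (\<lambda>i. \<xi> (i div r)) j \<omega>\<bar> > \<kappa>}"
      unfolding Q_def
      using step_integral_grid[OF \<open>0 < h\<close> r, of _ K s \<xi>] by (auto simp: r_def)
    have div: "i div r < K" if "i < K * r" for i
      using that r by (simp add: less_mult_imp_div_less)
    have meas: "\<xi> (i div r) \<in> borel_measurable (F (?\<tau> i))" if "i < K * r" for i
    proof (rule measurable_filtration_mono[OF _ _ \<xi>[OF div[OF that]]])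
      have "real (i div r) \<le> real i / real r"
        by (rule of_nat_div_le_of_nat)
      then have "real (i div r) * h \<le> real i / real r * h"
        using assms by (intro mult_right_mono) auto
      then show "s + real (i div r) * h \<le> ?\<tau> i" by simp
    qed (use assms in auto)
    have bd': "\<bar>\<xi> (i div r) \<omega>\<bar> \<le> C" if "i < K * r" "\<omega> \<in> space M" for i \<omega>
      using bd[OF div] that by auto
    note max = transform_maximal[OF \<tau>, of "K * r" "\<lambda>i. \<xi> (i div r)", OF meas bd' \<open>0 < \<kappa>\<close>]
    have "(\<Sum>i<K * r. (\<integral>\<omega>. (\<xi> (i div r) \<omega>)\<^sup>2 \<partial>M) * (?\<tau> (Suc i) - ?\<tau> i))
      = (\<Sum>k<K. \<Sum>i = k * r..<k * r + r. (\<integral>\<omega>. (\<xi> (i div r) \<omega>)\<^sup>2 \<partial>M) * (h / real r))"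
      by (subst sum.nat_group) (simp add: distrib_right add_divide_distrib)
    also have "\<dots> = (\<Sum>k<K. \<Sum>i = k * r..<k * r + r. (\<integral>\<omega>. (\<xi> k \<omega>)\<^sup>2 \<partial>M) * (h / real r))"
    proof (intro sum.cong refl)
      fix k i assume "i \<in> {k * r..<k * r + r}"
      then have "i div r = k"
        by (intro div_nat_eqI) (auto simp: mult.commute)
      then show "(\<integral>\<omega>. (\<xi> (i div r) \<omega>)\<^sup>2 \<partial>M) * (h / real r) = (\<integral>\<omega>. (\<xi> k \<omega>)\<^sup>2 \<partial>M) * (h / real r)"
        by simp
    qed
    also have "\<dots> = h * (\<Sum>k<K. \<integral>\<omega>. (\<xi> k \<omega>)\<^sup>2 \<partial>M)"
      using r by (simp add: sum_distrib_left mult.commute)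
    finally have sum_eq: "(\<Sum>i<K * r. (\<integral>\<omega>. (\<xi> (i div r) \<omega>)\<^sup>2 \<partial>M) * (?\<tau> (Suc i) - ?\<tau> i))
      = h * (\<Sum>k<K. \<integral>\<omega>. (\<xi> k \<omega>)\<^sup>2 \<partial>M)" .
    have end_eq: "?\<tau> (K * r) = s + real K * h" using r by simp
    show ?thesis
      using max(1)[unfolded end_eq] max(2)[unfolded sum_eq] unfolding Q_eq by (rule conjI)
  qed
  show "exceedance s h K \<xi> \<kappa> \<in> sets (F (s + real K * h))"
    unfolding eq using Q by (intro sets.countable_UN) auto
  have "0 \<le> s + real K * h" using assms by simp
  then have Qev: "range Q \<subseteq> events" using Q sets_filtration_le[of "s + real K * h"] by blast
  \<comment> \<open>The grid of level \<open>m\<close> sits inside the next one, with index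
    \<open>j\<close> becoming \<open>2 * j\<close>.\<close>
  have "incseq Q"
  proof (rule incseq_SucI, rule subsetI)
    fix m \<omega> assume "\<omega> \<in> Q m"
    then obtain j where j: "\<omega> \<in> space M" "j \<le> K * 2 ^ m" "\<bar>?Z (s + real j * (h / 2 ^ m)) \<omega>\<bar> > \<kappa>"
      by (auto simp: Q_def)
    then have "2 * j \<le> K * 2 ^ Suc m" "\<bar>?Z (s + real (2 * j) * (h / 2 ^ Suc m)) \<omega>\<bar> > \<kappa>"
      by auto
    then show "\<omega> \<in> Q (Suc m)" using \<open>\<omega> \<in> space M\<close> unfolding Q_def by blast
  qed
  then have "(\<lambda>m. measure M (Q m)) \<longlonglongrightarrow> measure M (\<Union>m. Q m)"
    by (intro finite_Lim_measure_incseq Qev)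
  then show "measure M (exceedance s h K \<xi> \<kappa>) \<le> h * (\<Sum>k<K. \<integral>\<omega>. (\<xi> k \<omega>)\<^sup>2 \<partial>M) / \<kappa>\<^sup>2"
    unfolding eq using Q by (intro LIMSEQ_le_const2) auto
qed

end

section \<open>Frequently recurring events\<close>

context prob_space
begin

text \<open>A Chernoff bound without independence: hypothesis \<open>p\<close> says that on any past
  event \<open>A n\<close> has conditional probability at least \<open>p\<close>. The expectation of
  2 to the power minus the count therefore decays geometrically, and by Markov's inequality and
  Borel-Cantelli the count falls below a fixed positive fraction of \<open>n\<close> only finitely
  often.\<close>

lemma frequent_events:
  fixes G :: "nat \<Rightarrow> 'a measure" and A :: "nat \<Rightarrow> 'a set"
  assumes sub: "\<And>n. subalgebra M (G n)" and mono: "\<And>n. sets (G n) \<subseteq> sets (G (Suc n))"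
    and A: "\<And>n. A n \<in> sets (G (Suc n))"
    and "0 < p" and p: "\<And>n B. B \<in> sets (G n) \<Longrightarrow> p * prob B \<le> prob (B \<inter> A n)"
  shows "\<exists>\<kappa>>0. AE \<omega> in M. \<forall>\<^sub>F n in sequentially. \<kappa> * real n \<le> real (card {k. k < n \<and> \<omega> \<in> A k})"
proof -
  define N where "N n \<omega> = card {k. k < n \<and> \<omega> \<in> A k}" for n \<omega>
  \<comment> \<open>The factor by which the expectation of \<open>Z n\<close> below shrinks at each
    step: \<open>Z\<close> is halved on \<open>A n\<close>, which carries at least the share
    \<open>p\<close> of its expectation.\<close>
  define r where "r = 1 - p / 2"
  have G_space: "space (G n) = space M" for n
    using sub[of n] by (simp add: subalgebra_def)
  have G_sets: "sets (G n) \<subseteq> events" for n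
    using sub[of n] by (simp add: subalgebra_def)
  have A_ev [measurable]: "A n \<in> events" for n using A G_sets by blast
  have "p * prob (space M) \<le> prob (space M \<inter> A 0)"
    using p[of "space M" 0] sets.top[of "G 0"] G_space by simp
  then have "p \<le> 1" 
    using prob_space by (auto intro: order_trans[OF _ prob_le_1])
  then have r: "0 < r" "r < 1" using \<open>0 < p\<close> by (auto simp: r_def)
  have N_Suc: "N (Suc n) \<omega> = N n \<omega> + (if \<omega> \<in> A n then 1 else 0)" for n \<omega>
  proof -
    have "{k. k < Suc n \<and> \<omega> \<in> A k} = {k. k < n \<and> \<omega> \<in> A k} \<union> (if \<omega> \<in> A n then {n} else {})"
      by (auto simp: less_Suc_eq)
    then show ?thesis by (simp add: N_def)
  qed
  have N_le: "N n \<omega> \<le> n" for n \<omega>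
    by (induction n) (auto simp: N_Suc, simp add: N_def)
  have N_meas: "{\<omega> \<in> space M. N n \<omega> = j} \<in> sets (G n)" for n j
  proof (induction n arbitrary: j)
    case 0
    then show ?case using sets.top[of "G 0"] G_space by (simp add: N_def)
  next
    case (Suc n)
    have IH: "{\<omega> \<in> space M. N n \<omega> = j} \<in> sets (G (Suc n))" for j
      using Suc mono by blast
    have eq: "{\<omega> \<in> space M. N (Suc n) \<omega> = j} =
        ({\<omega> \<in> space M. N n \<omega> = j} - A n) \<union> ({\<omega> \<in> space M. Suc (N n \<omega>) = j} \<inter> A n)"
      by (auto simp: N_Suc)
    have "{\<omega> \<in> space M. Suc (N n \<omega>) = j} \<in> sets (G (Suc n))"
      using IH by (cases j) auto
    then show ?case unfolding eq using IH A by auto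
  qed
  define Z where "Z n \<omega> = (1 / 2 :: real) ^ N n \<omega>" for n \<omega>
  \<comment> \<open>The hypothesis on \<open>p\<close> concerns events, so \<open>Z n\<close> is
    written as a finite combination of indicators of level sets of the count, which belong to
    \<open>G n\<close>.\<close>
  have Z_eq: "Z n \<omega> = (\<Sum>j\<le>n. (1 / 2) ^ j * indicator {\<omega> \<in> space M. N n \<omega> = j} \<omega>)"
    if "\<omega> \<in> space M" for n \<omega>
  proof -
    have "(\<Sum>j\<le>n. (1 / 2) ^ j * indicator {\<omega> \<in> space M. N n \<omega> = j} \<omega>)
        = (\<Sum>j\<le>n. if j = N n \<omega> then (1 / 2 :: real) ^ j else 0)"
      using that by (intro sum.cong) (auto simp: indicator_def)
    then show ?thesis using N_le by (simp add: Z_def)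
  qed
  have N_ev [measurable]: "{\<omega> \<in> space M. N n \<omega> = j} \<in> events" for n j
    using N_meas G_sets by blast
  have Z_meas [measurable]: "Z n \<in> borel_measurable M" for n
    by (rule measurable_cong[OF Z_eq, THEN iffD2])
       (assumption, intro borel_measurable_sum borel_measurable_times borel_measurable_indicator
         borel_measurable_const N_ev)
  have Z_int: "integrable M (Z n)" for n
    by (rule integrable_const_bound[of _ 1]) (auto simp: Z_def power_le_one)
  have Z_int': "integrable M (\<lambda>\<omega>. Z n \<omega> * indicator (A n) \<omega>)" for n
    by (rule integrable_real_mult_indicator[OF A_ev Z_int])
  have step: "p * expectation (Z n) \<le> expectation (\<lambda>\<omega>. Z n \<omega> * indicator (A n) \<omega>)" for n
  proof -
    have "expectation (Z n) = (\<integral>\<omega>. (\<Sum>j\<le>n. (1 / 2) ^ j * indicator {\<omega> \<in> space M. N n \<omega> = j} \<omega>) \<partial>M)"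
      by (intro Bochner_Integration.integral_cong Z_eq) auto
    also have "\<dots> = (\<Sum>j\<le>n. (1 / 2) ^ j * prob {\<omega> \<in> space M. N n \<omega> = j})"
      by (subst Bochner_Integration.integral_sum)
         (auto intro!: integrable_mult_right simp: integrable_indicator_iff emeasure_eq_measure)
    finally have 1: "expectation (Z n) = (\<Sum>j\<le>n. (1 / 2) ^ j * prob {\<omega> \<in> space M. N n \<omega> = j})" .
    have "expectation (\<lambda>\<omega>. Z n \<omega> * indicator (A n) \<omega>) =
        (\<integral>\<omega>. (\<Sum>j\<le>n. (1 / 2) ^ j * indicator ({\<omega> \<in> space M. N n \<omega> = j} \<inter> A n) \<omega>) \<partial>M)"
      by (intro Bochner_Integration.integral_cong)
         (auto simp: Z_eq sum_distrib_right indicator_def)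
    also have "\<dots> = (\<Sum>j\<le>n. (1 / 2) ^ j * prob ({\<omega> \<in> space M. N n \<omega> = j} \<inter> A n))"
      by (subst Bochner_Integration.integral_sum)
         (auto intro!: integrable_mult_right simp: integrable_indicator_iff emeasure_eq_measure)
    finally have 2: "expectation (\<lambda>\<omega>. Z n \<omega> * indicator (A n) \<omega>) =
        (\<Sum>j\<le>n. (1 / 2) ^ j * prob ({\<omega> \<in> space M. N n \<omega> = j} \<inter> A n))" .
    have "p * ((1 / 2) ^ j * prob {\<omega> \<in> space M. N n \<omega> = j})
        \<le> (1 / 2) ^ j * prob ({\<omega> \<in> space M. N n \<omega> = j} \<inter> A n)" for j
      using mult_left_mono[OF p[OF N_meas[of n j]], of "(1 / 2) ^ j"] by (simp add: mult_ac)
    then show ?thesis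
      unfolding 1 2 sum_distrib_left by (intro sum_mono)
  qed
  have Z_bound: "expectation (Z n) \<le> r ^ n" for n
  proof (induction n)
    case 0
    then show ?case by (simp add: Z_def N_def prob_space)
  next
    case (Suc n)
    have "expectation (Z (Suc n)) = (\<integral>\<omega>. Z n \<omega> - 1 / 2 * (Z n \<omega> * indicator (A n) \<omega>) \<partial>M)"
      by (intro Bochner_Integration.integral_cong) (auto simp: Z_def N_Suc indicator_def)
    also have "\<dots> = expectation (Z n) - 1 / 2 * expectation (\<lambda>\<omega>. Z n \<omega> * indicator (A n) \<omega>)"
      using Z_int Z_int' by simp
    also have "\<dots> \<le> r * expectation (Z n)"
      using step[of n] by (simp add: r_def algebra_simps)
    also have "\<dots> \<le> r * r ^ n" using Suc r by (intro mult_left_mono) auto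
    finally show ?case by simp
  qed
  have r': "0 < sqrt r" "sqrt r < 1" using r by auto
  \<comment> \<open>Since \<open>sqrt r\<close> lies strictly between \<open>r\<close> and 1, its
    powers are at once a threshold that \<open>Z n\<close> rarely reaches and a summable bound for
    the probability of reaching it.\<close>
  have tail: "prob {\<omega> \<in> space M. Z n \<omega> \<ge> sqrt r ^ n} \<le> sqrt r ^ n" for n
  proof -
    have "prob {\<omega> \<in> space M. Z n \<omega> \<ge> sqrt r ^ n} \<le> expectation (Z n) / sqrt r ^ n"
      using r' by (intro integral_Markov_inequality_measure[OF Z_int, of "{}"]) (auto simp: Z_def)
    also have "\<dots> \<le> r ^ n / sqrt r ^ n"
      using Z_bound r' by (intro divide_right_mono) auto
    also have "r ^ n = sqrt r ^ n * sqrt r ^ n"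
      using r by (simp flip: power_mult_distrib)
    finally show ?thesis using r' by simp
  qed
  have "AE \<omega> in M. \<forall>\<^sub>F n in sequentially. \<omega> \<in> space M - {\<omega> \<in> space M. Z n \<omega> \<ge> sqrt r ^ n}"
  proof (rule borel_cantelli_AE1)
    show "summable (\<lambda>n. prob {\<omega> \<in> space M. sqrt r ^ n \<le> Z n \<omega>})"
      using tail r' by (intro summable_comparison_test'[OF summable_geometric[of "sqrt r"], of 0]) auto
  qed (auto simp: emeasure_eq_measure)
  \<comment> \<open>Obtained by taking logarithms in \<open>Z n \<omega> < sqrt r ^ n\<close>; both
    logarithms are negative.\<close>
  moreover define \<kappa> where "\<kappa> = ln (sqrt r) / ln (1 / 2)"
  have "\<kappa> * real n \<le> real (N n \<omega>)" if "Z n \<omega> < sqrt r ^ n" for n \<omega>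
  proof -
    have "ln (Z n \<omega>) < ln (sqrt r ^ n)"
      using that r' by (subst ln_less_cancel_iff) (auto simp: Z_def)
    then have "real (N n \<omega>) * ln (1 / 2) < real n * ln (sqrt r)"
      using r' by (simp add: Z_def ln_realpow)
    moreover have "ln (1 / 2 :: real) < 0" by simp
    ultimately show ?thesis
      unfolding \<kappa>_def by (simp add: field_simps)
  qed
  then have "(\<forall>\<^sub>F n in sequentially. \<omega> \<in> space M - {\<omega> \<in> space M. Z n \<omega> \<ge> sqrt r ^ n}) \<longrightarrow>
      (\<forall>\<^sub>F n in sequentially. \<kappa> * real n \<le> real (N n \<omega>))" for \<omega>
    by (auto elim!: eventually_mono)
  ultimately have "AE \<omega> in M. \<forall>\<^sub>F n in sequentially. \<kappa> * real n \<le> real (N n \<omega>)"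
    by (auto elim!: AE_mp)
  moreover have "\<kappa> > 0"
    unfolding \<kappa>_def using r' by (intro divide_neg_neg) auto
  ultimately show ?thesis unfolding N_def by blast
qed

end

section \<open>Brownian pushes in a prescribed direction\<close>

definition std_normal_tail :: real where
  "std_normal_tail = measure (density lborel std_normal_density) {1..}"

lemma std_normal_tail_pos: "0 < std_normal_tail"
proof -
  interpret N: prob_space "density lborel std_normal_density"
    by (rule prob_space_normal_density) simp
  have "std_normal_tail \<noteq> 0"
  proof
    assume "std_normal_tail = 0"
    then have "{1..} \<in> null_sets (density lborel std_normal_density)"
      by (auto simp: std_normal_tail_def N.emeasure_eq_measure intro!: null_setsI)
    then have "AE x\<in>{1..} in lborel. ennreal (std_normal_density x) = 0"
      by (subst (asm) null_sets_density_iff) auto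
    then have "AE x in lborel. x \<notin> {1..2::real}"
    proof eventually_elim
      case (elim x)
      have "0 < std_normal_density x" by (simp add: normal_density_pos)
      then show ?case using elim by (auto simp: ennreal_eq_0_iff)
    qed
    then have "emeasure lborel {1..2::real} = 0"
      by (subst (asm) AE_iff_measurable[where N="{1..2}"]) auto
    then show False by simp
  qed
  then show ?thesis by (simp add: std_normal_tail_def zero_less_measure_iff)
qed

context brownian_space
begin

text \<open>By scaling and symmetry, a move of at least one standard deviation in a given direction
  has the same probability for all steps, however short. This leaves \<open>h\<close> free to be
  chosen later.\<close>

lemma increment_tail:
  assumes "0 \<le> s" "0 < h" "\<bar>a\<bar> = 1"
  shows "measure M {\<omega> \<in> space M. a * (W (s + h) \<omega> - W s \<omega>) \<ge> sqrt h} = std_normal_tail"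
proof -
  let ?D = "\<lambda>\<omega>. 0 + (a / sqrt h) * (W (s + h) \<omega> - W s \<omega>)"
  have "distributed M lborel (\<lambda>\<omega>. W (s + h) \<omega> - W s \<omega>) (normal_density 0 (sqrt h))"
    using increment_distributed[of s "s + h"] assms by simp
  then have "distributed M lborel ?D
      (normal_density (0 + (a / sqrt h) * 0) (\<bar>a / sqrt h\<bar> * sqrt h))"
    using assms by (intro normal_density_affine) auto
  moreover have "\<bar>a / sqrt h\<bar> * sqrt h = 1" using assms by simp
  ultimately have D: "distributed M lborel ?D std_normal_density"
    by (simp only: mult_zero_right add_0_right)
  then have meas: "?D \<in> measurable M lborel" by (rule distributed_measurable)
  have "std_normal_tail = measure (distr M lborel ?D) {1..}"
    unfolding std_normal_tail_def distributed_distr_eq_density[OF D] ..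
  also have "\<dots> = measure M (?D -` {1..} \<inter> space M)"
    by (rule measure_distr[OF meas]) simp
  also have "?D -` {1..} \<inter> space M = {\<omega> \<in> space M. a * (W (s + h) \<omega> - W s \<omega>) \<ge> sqrt h}"
    using \<open>0 < h\<close> by (auto simp: field_simps)
  finally show ?thesis by simp
qed

text \<open>Chosen so that the maximal inequality on a step of length \<open>h\<close> bounds the
  probability of exceeding this level by \<open>std_normal_tail / 2\<close>. Thus at least half of
  the probability of a favourable increment remains when oscillating paths are removed. The level is
  of order \<open>sqrt h\<close>.\<close>

definition oscillation_level :: "real \<Rightarrow> real" where
  "oscillation_level h = sqrt (2 * h / std_normal_tail)"

text \<open>With a single cell and integrand 1, the step integral is the displacement of
  \<open>W\<close> since time \<open>s\<close>.\<close>

definition push_event :: "real \<Rightarrow> real \<Rightarrow> real \<Rightarrow> 'a set" where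
  "push_event h s a = {\<omega> \<in> space M. a * (W (s + h) \<omega> - W s \<omega>) \<ge> sqrt h}
     - exceedance s h 1 (\<lambda>_ _. 1) (oscillation_level h)"

lemma push_eventD:
  assumes "\<omega> \<in> push_event h s a" "continuous_on {0..} (\<lambda>t. W t \<omega>)" "0 \<le> s" "0 < h"
  shows "a * (W (s + h) \<omega> - W s \<omega>) \<ge> sqrt h"
    and "\<And>t. s \<le> t \<Longrightarrow> t \<le> s + h \<Longrightarrow> \<bar>W t \<omega> - W s \<omega>\<bar> \<le> oscillation_level h"
proof -
  show "a * (W (s + h) \<omega> - W s \<omega>) \<ge> sqrt h"
    using assms by (auto simp: push_event_def)
  fix t assume t: "s \<le> t" "t \<le> s + h"
  show "\<bar>W t \<omega> - W s \<omega>\<bar> \<le> oscillation_level h"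
  proof (rule ccontr)
    assume "\<not> \<bar>W t \<omega> - W s \<omega>\<bar> \<le> oscillation_level h"
    then have "\<omega> \<in> exceedance s h 1 (\<lambda>_ _. 1) (oscillation_level h)"
      using assms t by (intro exceedanceI[of _ s h t]) (auto simp: step_integral_def push_event_def)
    then show False using assms by (auto simp: push_event_def)
  qed
qed

lemma push_event_prob:
  assumes "0 \<le> s" "0 < h" "\<bar>a\<bar> = 1"
  shows "push_event h s a \<in> sets (F (s + h))"
    and "\<And>B. B \<in> sets (F s) \<Longrightarrow> std_normal_tail / 2 * prob B \<le> prob (B \<inter> push_event h s a)"
proof -
  let ?U = "{\<omega> \<in> space M. a * (W (s + h) \<omega> - W s \<omega>) \<ge> sqrt h}"
  let ?E = "exceedance s h 1 (\<lambda>_ _. 1) (oscillation_level h)"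
  have level: "0 < oscillation_level h" "(oscillation_level h)\<^sup>2 = 2 * h / std_normal_tail"
    using std_normal_tail_pos assms by (auto simp: oscillation_level_def)
  have E: "?E \<in> sets (F (s + h))"
    using exceedance_bound(1)[of s h "oscillation_level h" 1 "\<lambda>_ _. 1" 1] level assms by simp
  have [measurable]: "W (s + h) \<in> borel_measurable (F (s + h))" "W s \<in> borel_measurable (F (s + h))"
    using assms by (auto intro!: W_adapted)
  have "{\<omega> \<in> space (F (s + h)). a * (W (s + h) \<omega> - W s \<omega>) \<ge> sqrt h} \<in> sets (F (s + h))"
    by measurable
  then have U: "?U \<in> sets (F (s + h))" using assms by (simp add: space_filtration)
  then show "push_event h s a \<in> sets (F (s + h))"
    unfolding push_event_def using E by auto
  have ev: "?U \<in> events" "?E \<in> events"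
    using U E sets_filtration_le[of "s + h"] assms by auto
  fix B assume B: "B \<in> sets (F s)"
  then have Bev: "B \<in> events" using sets_filtration_le[of s] assms by auto
  have "indep_set (sets (F s)) {(\<lambda>\<omega>. W (s + h) \<omega> - W s \<omega>) -` A \<inter> space M | A. A \<in> sets borel}"
    using brownian assms by (auto simp: brownian_motion_def)
  moreover have "?U = (\<lambda>\<omega>. W (s + h) \<omega> - W s \<omega>) -` {x. a * x \<ge> sqrt h} \<inter> space M"
    by auto
  moreover have "{x. a * x \<ge> sqrt h} \<in> sets borel" by measurable
  ultimately have BU: "prob (B \<inter> ?U) = prob B * std_normal_tail"
    using B indep_setD increment_tail[OF assms] by (metis (mono_tags, lifting) mem_Collect_eq)
  \<comment> \<open>Independence of the past is available for the increment, not for the running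
    supremum. Applying the maximal inequality to the integrand \<open>indicator B\<close> instead
    bounds precisely the part of the exceedance event inside \<open>B\<close>, with second moment
    \<open>prob B\<close>.\<close>
  let ?\<xi> = "\<lambda>(_::nat) \<omega>. indicator B \<omega> :: real"
  let ?EB = "exceedance s h 1 ?\<xi> (oscillation_level h)"
  have xi: "?\<xi> k \<in> borel_measurable (F (s + real k * h))" if "k < 1" for k
    using that B by simp
  have "prob ?EB \<le> h * (\<Sum>k<1. \<integral>\<omega>. (?\<xi> k \<omega>)\<^sup>2 \<partial>M) / (oscillation_level h)\<^sup>2"
    using level assms by (intro exceedance_bound(2)[of _ _ _ _ _ 1] xi) auto
  also have "(\<Sum>k<1. \<integral>\<omega>. (?\<xi> k \<omega>)\<^sup>2 \<partial>M) = prob B"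
  proof -
    have "(?\<xi> k \<omega>)\<^sup>2 = ?\<xi> k \<omega>" for k \<omega> by (simp add: indicator_def)
    then show ?thesis using Bev sets.Int_space_eq2 by simp
  qed
  finally have EB: "prob ?EB \<le> prob B * std_normal_tail / 2"
    using level assms by simp
  have EBev: "?EB \<in> events"
    using exceedance_bound(1)[of s h "oscillation_level h" 1 ?\<xi> 1] xi level assms
      sets_filtration_le[of "s + h"] by auto
  have "B \<inter> ?U \<subseteq> (B \<inter> push_event h s a) \<union> ?EB"
  proof -
    have "\<omega> \<in> ?E \<longleftrightarrow> \<omega> \<in> ?EB" if "\<omega> \<in> B" for \<omega>
      using that by (simp add: exceedance_def step_integral_def)
    then show ?thesis by (auto simp: push_event_def)
  qed
  moreover have "B \<inter> push_event h s a \<in> events"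
    using ev Bev by (auto simp: push_event_def)
  ultimately have "prob (B \<inter> ?U) \<le> prob (B \<inter> push_event h s a) + prob ?EB"
    using EBev by (intro order_trans[OF finite_measure_mono measure_Un_le]) auto
  then show "std_normal_tail / 2 * prob B \<le> prob (B \<inter> push_event h s a)"
    using BU EB by (simp add: field_simps)
qed

definition push_sequence :: "real \<Rightarrow> (nat \<Rightarrow> real) \<Rightarrow> nat \<Rightarrow> real \<Rightarrow> 'a set" where
  "push_sequence h a n s = {\<omega> \<in> space M. \<forall>k<n. \<omega> \<in> push_event h (s + real k * h) (a k)}"

text \<open>\<open>B\<close> intersected with the first \<open>n\<close> pushes is itself a past
  event for the next push, so the one-step bound can be iterated.\<close>

lemma push_sequence_prob:
  assumes "0 \<le> s" "0 < h" "\<And>k. \<bar>a k\<bar> = 1"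
  shows "push_sequence h a n s \<in> sets (F (s + real n * h)) \<and>
    (\<forall>B\<in>sets (F s). (std_normal_tail / 2) ^ n * prob B \<le> prob (B \<inter> push_sequence h a n s))"
proof (induction n)
  case 0
  have "B \<inter> space M = B" if "B \<in> sets (F s)" for B
    using sets.sets_into_space[OF that] space_filtration[OF \<open>0 \<le> s\<close>] by auto
  then show ?case
    using sets.top[of "F s"] space_filtration[OF \<open>0 \<le> s\<close>] by (simp add: push_sequence_def)
next
  case (Suc n)
  let ?t = "s + real n * h"
  have pos: "0 \<le> ?t" "s \<le> ?t" using assms by auto
  have t': "s + real (Suc n) * h = ?t + h" by (simp add: algebra_simps)
  have eq: "push_sequence h a (Suc n) s = push_sequence h a n s \<inter> push_event h ?t (a n)"
    by (auto simp: push_sequence_def less_Suc_eq)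
  note push = push_event_prob[OF pos(1) assms(2) assms(3)[of n]]
  have "push_sequence h a n s \<in> sets (F (?t + h))"
    using Suc sets_filtration_mono[of ?t "?t + h"] pos \<open>0 < h\<close> by auto
  moreover have "(std_normal_tail / 2) ^ Suc n * prob B \<le> prob (B \<inter> push_sequence h a (Suc n) s)"
    if B: "B \<in> sets (F s)" for B
  proof -
    have "B \<inter> push_sequence h a n s \<in> sets (F ?t)"
      using B Suc sets_filtration_mono[OF \<open>0 \<le> s\<close> pos(2)] by auto
    from push(2)[OF this]
    have "std_normal_tail / 2 * prob (B \<inter> push_sequence h a n s)
        \<le> prob (B \<inter> push_sequence h a (Suc n) s)"
      by (simp add: eq Int_assoc)
    moreover have "std_normal_tail / 2 * ((std_normal_tail / 2) ^ n * prob B)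
        \<le> std_normal_tail / 2 * prob (B \<inter> push_sequence h a n s)"
      using Suc B std_normal_tail_pos by (intro mult_left_mono) auto
    ultimately show ?thesis by simp
  qed
  ultimately show ?case
    unfolding t' eq using push(1) by auto
qed

text \<open>Blocks of \<open>m\<close> steps are laid end to end, and the filtration is sampled at
  their boundaries.\<close>

lemma frequent_push_sequences:
  assumes "0 < h" "\<And>k. \<bar>a k\<bar> = 1"
  shows "\<exists>\<kappa>>0. AE \<omega> in M. \<forall>\<^sub>F n in sequentially.
    \<kappa> * real n \<le> real (card {k. k < n \<and> \<omega> \<in> push_sequence h a m (real k * (real m * h))})"
proof (rule frequent_events)
  let ?G = "\<lambda>n. F (real n * (real m * h))"
  have pos: "0 \<le> real n * (real m * h)" for n using \<open>0 < h\<close> by simp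
  have next_eq: "real n * (real m * h) + real m * h = real (Suc n) * (real m * h)" for n
    by (simp add: algebra_simps)
  have block: "push_sequence h a m (real n * (real m * h)) \<in> sets (F (real n * (real m * h) + real m * h)) \<and>
    (\<forall>B\<in>sets (?G n). (std_normal_tail / 2) ^ m * prob B
      \<le> prob (B \<inter> push_sequence h a m (real n * (real m * h))))" for n
    by (intro push_sequence_prob pos assms)
  show "subalgebra M (?G n)" for n by (rule subalg[OF pos])
  show "sets (?G n) \<subseteq> sets (?G (Suc n))" for n
    using \<open>0 < h\<close> by (intro sets_filtration_mono[OF pos] mult_right_mono) auto
  show "push_sequence h a m (real n * (real m * h)) \<in> sets (?G (Suc n))" for n
    using block[of n] unfolding next_eq by simp
  show "0 < (std_normal_tail / 2) ^ m" using std_normal_tail_pos by simp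
  show "(std_normal_tail / 2) ^ m * prob B \<le> prob (B \<inter> push_sequence h a m (real n * (real m * h)))"
    if "B \<in> sets (?G n)" for n B
    using block[of n] that by simp
qed

end

section \<open>Occupation time along a reflected path\<close>

text \<open>The point is the least element of the compact level set; a larger value before it would
  force an earlier crossing.\<close>

lemma first_passage:
  fixes g :: "real \<Rightarrow> real"
  assumes "continuous_on {p..q} g" "p \<le> q" "g p < r" "r < g q"
  obtains v where "v \<in> {p..q}" "g v = r" "\<And>w. w \<in> {p..v} \<Longrightarrow> g w \<le> r"
proof -
  define S where "S = {w \<in> {p..q}. g w = r}"
  have "closed S"
    unfolding S_def using assms(1) by (rule continuous_closed_preimage_constant) simp
  moreover have "S \<subseteq> {p..q}" by (auto simp: S_def)
  ultimately have "compact S"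
    by (metis compact_Icc closed_Int_compact inf.absorb1)
  moreover have "S \<noteq> {}"
    using IVT'[of g p r q] assms by (auto simp: S_def)
  ultimately obtain v where v: "v \<in> S" "\<And>w. w \<in> S \<Longrightarrow> v \<le> w"
    using compact_attains_inf by metis
  have "g w \<le> r" if w: "w \<in> {p..v}" for w
  proof (rule ccontr)
    assume "\<not> g w \<le> r"
    moreover have "continuous_on {p..w} g"
      by (rule continuous_on_subset[OF assms(1)]) (use w v(1) in \<open>auto simp: S_def\<close>)
    ultimately obtain w' where "w' \<in> {p..w}" "g w' = r"
      using IVT'[of g p r w] assms w by auto
    then have "v \<le> w'" using v w by (auto simp: S_def)
    then have "w' = w" using w \<open>w' \<in> {p..w}\<close> by auto
    then show False using \<open>g w' = r\<close> \<open>\<not> g w \<le> r\<close> by simp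
  qed
  then show ?thesis using that[of v] v(1) by (auto simp: S_def)
qed

text \<open>The Stieltjes measure of a half-open interval is the increment of \<open>G\<close> over
  it. This turns the integral conditions on \<open>L\<close> and \<open>R\<close> into the usable
  form: each is constant while \<open>X\<close> avoids its barrier.\<close>

lemma interval_measure_flat:
  fixes G :: "real \<Rightarrow> real"
  assumes cont: "continuous_on {0..} G" and mono: "mono_on {0..} G"
    and null: "(\<integral>\<^sup>+ r. indicator A r \<partial>interval_measure (\<lambda>t. G (max 0 t))) = 0"
    and "0 \<le> s" "s \<le> t" "{s..t} \<subseteq> A"
  shows "G t = G s"
proof -
  let ?G = "\<lambda>t. G (max 0 t)"
  have "continuous_on UNIV ?G"
    by (rule continuous_on_compose2[OF cont]) (auto intro!: continuous_intros)
  then have "continuous (at_right a) ?G" for a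
    by (metis UNIV_I continuous_on_eq_continuous_within continuous_within_subset subset_UNIV)
  moreover have "?G a \<le> ?G b" if "a \<le> b" for a b
    using that by (intro mono_onD[OF mono]) auto
  ultimately have "emeasure (interval_measure ?G) {s<..t} = ennreal (?G t - ?G s)"
    using \<open>s \<le> t\<close> by (intro emeasure_interval_measure_Ioc) auto
  moreover have "emeasure (interval_measure ?G) {s<..t} \<le> 0"
  proof -
    have "emeasure (interval_measure ?G) {s<..t} = (\<integral>\<^sup>+ r. indicator {s<..t} r \<partial>interval_measure ?G)"
      by simp
    also have "\<dots> \<le> (\<integral>\<^sup>+ r. indicator A r \<partial>interval_measure ?G)"
      using \<open>{s..t} \<subseteq> A\<close> by (intro nn_integral_mono) (auto simp: indicator_def)
    finally show ?thesis using null by simp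
  qed
  ultimately have "G t \<le> G s" using assms by (simp add: ennreal_eq_0_iff)
  moreover have "G s \<le> G t" using assms by (intro mono_onD[OF mono]) auto
  ultimately show ?thesis by simp
qed

section \<open>Deterministic analysis of a single reflected path\<close>

locale reflected_path =
  fixes X W L R b :: "real \<Rightarrow> real" and \<sigma> l u x D :: real
  assumes X_cont: "continuous_on {0..} X" and X_range: "\<And>t. 0 \<le> t \<Longrightarrow> X t \<in> {l..u}"
    and L_cont: "continuous_on {0..} L" and L_mono: "mono_on {0..} L"
    and R_cont: "continuous_on {0..} R" and R_mono: "mono_on {0..} R"
    and X_eq: "\<And>t. 0 \<le> t \<Longrightarrow> X t = x + integral {0..t} (\<lambda>s. b (X s)) + \<sigma> * W t + L t - R t"
    and L_growth: "(\<integral>\<^sup>+ t. indicator {t. 0 \<le> t \<and> X t > l} t \<partial>interval_measure (\<lambda>t. L (max 0 t))) = 0"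
    and R_growth: "(\<integral>\<^sup>+ t. indicator {t. 0 \<le> t \<and> X t < u} t \<partial>interval_measure (\<lambda>t. R (max 0 t))) = 0"
    and \<sigma>_pos: "0 < \<sigma>" and b_cont: "continuous_on {l..u} b"
    and b_bound: "\<And>y. y \<in> {l..u} \<Longrightarrow> \<bar>b y\<bar> \<le> D"
begin

lemma L_flat: "0 \<le> s \<Longrightarrow> s \<le> t \<Longrightarrow> (\<And>r. r \<in> {s..t} \<Longrightarrow> l < X r) \<Longrightarrow> L t = L s"
  by (rule interval_measure_flat[OF L_cont L_mono L_growth]) auto

lemma R_flat: "0 \<le> s \<Longrightarrow> s \<le> t \<Longrightarrow> (\<And>r. r \<in> {s..t} \<Longrightarrow> X r < u) \<Longrightarrow> R t = R s"
  by (rule interval_measure_flat[OF R_cont R_mono R_growth]) auto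

lemma compose_integrable:
  fixes g :: "real \<Rightarrow> real"
  assumes "continuous_on {l..u} g" "0 \<le> s"
  shows "(\<lambda>r. g (X r)) integrable_on {s..t}"
proof (rule integrable_continuous_interval)
  have "continuous_on {s..t} X" by (rule continuous_on_subset[OF X_cont]) (use assms in auto)
  moreover have "X ` {s..t} \<subseteq> {l..u}" using X_range \<open>0 \<le> s\<close> by (intro image_subsetI) simp
  ultimately show "continuous_on {s..t} (\<lambda>r. g (X r))" by (rule continuous_on_compose2[OF assms(1)])
qed

lemma drift_bound:
  assumes "0 \<le> s" "s \<le> t"
  shows "\<bar>integral {s..t} (\<lambda>r. b (X r))\<bar> \<le> D * (t - s)"
proof -
  have "norm (integral {s..t} (\<lambda>r. b (X r))) \<le> integral {s..t} (\<lambda>r. D)"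
  proof (rule integral_norm_bound_integral)
    show "(\<lambda>r. b (X r)) integrable_on {s..t}" by (rule compose_integrable[OF b_cont \<open>0 \<le> s\<close>])
    show "norm (b (X r)) \<le> D" if "r \<in> {s..t}" for r
      using b_bound X_range that assms by simp
  qed auto
  then show ?thesis using assms by (simp add: mult.commute)
qed

lemma X_increment:
  assumes "0 \<le> s" "s \<le> t"
  shows "X t - X s = integral {s..t} (\<lambda>r. b (X r)) + \<sigma> * (W t - W s) + (L t - L s) - (R t - R s)"
proof -
  have "integral {0..s} (\<lambda>r. b (X r)) + integral {s..t} (\<lambda>r. b (X r)) = integral {0..t} (\<lambda>r. b (X r))"
    using assms by (intro Henstock_Kurzweil_Integration.integral_combine compose_integrable[OF b_cont]) auto
  then show ?thesis
    using X_eq[of s] X_eq[of t] assms by (simp add: algebra_simps)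
qed

text \<open>While \<open>X\<close> stays above \<open>c\<close>, it is off the lower barrier, so
  \<open>L\<close> is frozen, and \<open>R\<close> can only help the descent. The path would then
  fall by more than the width of the interval, wherever it started.\<close>

lemma push_down:
  assumes "0 \<le> s" "s \<le> t" "W t - W s \<le> - w" "u - l < \<sigma> * w - D * (t - s)" "l < c"
  shows "\<exists>r\<in>{s..t}. X r \<le> c"
proof (rule ccontr)
  assume "\<not> ?thesis"
  then have "l < X r" if "r \<in> {s..t}" for r using that \<open>l < c\<close> by force
  then have "L t = L s" using assms by (intro L_flat) auto
  moreover have "R s \<le> R t" using assms by (intro mono_onD[OF R_mono]) auto
  moreover have "\<sigma> * (W t - W s) \<le> \<sigma> * (- w)" using assms \<sigma>_pos by (intro mult_left_mono) auto
  ultimately show False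
    using X_increment[OF assms(1,2)] drift_bound[OF assms(1,2)] X_range[of s] X_range[of t] assms
    by (auto simp: abs_le_iff)
qed

lemma push_up:
  assumes "0 \<le> s" "s \<le> t" "W t - W s \<ge> w" "u - l < \<sigma> * w - D * (t - s)" "c < u"
  shows "\<exists>r\<in>{s..t}. X r \<ge> c"
proof (rule ccontr)
  assume "\<not> ?thesis"
  then have "X r < u" if "r \<in> {s..t}" for r using that \<open>c < u\<close> by force
  then have "R t = R s" using assms by (intro R_flat) auto
  moreover have "L s \<le> L t" using assms by (intro mono_onD[OF L_mono]) auto
  moreover have "\<sigma> * (W t - W s) \<ge> \<sigma> * w" using assms \<sigma>_pos by (intro mult_left_mono) auto
  ultimately show False
    using X_increment[OF assms(1,2)] drift_bound[OF assms(1,2)] X_range[of s] X_range[of t] assms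
    by (auto simp: abs_le_iff)
qed

lemma interior_increment:
  assumes "0 \<le> s" "s \<le> t" "\<And>r. r \<in> {s..t} \<Longrightarrow> l < X r \<and> X r < u"
  shows "\<bar>X t - X s\<bar> \<le> D * (t - s) + \<sigma> * \<bar>W t - W s\<bar>"
proof -
  have "L t = L s" by (rule L_flat[OF assms(1,2)]) (use assms(3) in blast)
  moreover have "R t = R s" by (rule R_flat[OF assms(1,2)]) (use assms(3) in blast)
  ultimately have "\<bar>X t - X s\<bar> \<le> \<bar>integral {s..t} (\<lambda>r. b (X r))\<bar> + \<bar>\<sigma> * (W t - W s)\<bar>"
    using X_increment[OF assms(1,2)] by simp
  then show ?thesis
    using drift_bound[OF assms(1,2)] \<sigma>_pos by (simp add: abs_mult)
qed

text \<open>Until it is at distance \<open>r\<close> from \<open>c\<close>, the path is strictly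
  inside the interval, so only drift and noise move it, and by \<open>small\<close> they cannot move
  it by \<open>r\<close>. The factor 2 is due to oscillations being measured from the start
  \<open>s\<close> of the step and not from the visiting time \<open>z\<close>.\<close>

lemma stays_near:
  assumes "0 \<le> s" "z \<in> {s..s + h}" "X z = c"
    and osc: "\<And>t. t \<in> {s..s + h} \<Longrightarrow> \<bar>W t - W s\<bar> \<le> \<eta>"
    and small: "D * h + 2 * \<sigma> * \<eta> < r" and room: "l < c - r" "c + r < u"
    and "t \<in> {s..s + h}"
  shows "\<bar>X t - c\<bar> \<le> r"
proof (rule ccontr)
  let ?g = "\<lambda>v. \<bar>X v - c\<bar>"
  assume far: "\<not> \<bar>X t - c\<bar> \<le> r"
  have D: "0 \<le> D" using b_bound[OF X_range[of 0]] by force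
  have "0 \<le> \<eta>" using osc[of s] \<open>z \<in> {s..s + h}\<close> by auto
  then have "0 < r" using small D \<sigma>_pos \<open>z \<in> {s..s + h}\<close>
    by (auto intro!: order.strict_trans1[OF _ small] add_nonneg_nonneg mult_nonneg_nonneg)
  have reach: False if "p \<in> {s..s + h}" "q \<in> {s..s + h}" "p \<le> q" "\<bar>X q - X p\<bar> = r"
    and "\<And>w. w \<in> {p..q} \<Longrightarrow> \<bar>X w - c\<bar> \<le> r" for p q
  proof -
    have "l < X w \<and> X w < u" if "w \<in> {p..q}" for w
      using \<open>\<And>w. w \<in> {p..q} \<Longrightarrow> \<bar>X w - c\<bar> \<le> r\<close>[OF that] room by (auto simp: abs_le_iff)
    then have "r \<le> D * (q - p) + \<sigma> * \<bar>W q - W p\<bar>"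
      using interior_increment[of p q] that \<open>0 \<le> s\<close> by auto
    also have "\<dots> \<le> D * h + \<sigma> * (2 * \<eta>)"
      using D \<sigma>_pos osc[of p] osc[of q] that by (intro add_mono mult_left_mono) auto
    finally show False using small by simp
  qed
  have gcont: "continuous_on {s..s + h} ?g"
    by (intro continuous_intros continuous_on_subset[OF X_cont]) (use \<open>0 \<le> s\<close> in auto)
  show False
  proof (cases "z \<le> t")
    case True
    have "continuous_on {z..t} ?g"
      by (rule continuous_on_subset[OF gcont]) (use assms in auto)
    then obtain v where "v \<in> {z..t}" "?g v = r" "\<And>w. w \<in> {z..v} \<Longrightarrow> ?g w \<le> r"
      using first_passage[of z t ?g r] True far \<open>0 < r\<close> \<open>X z = c\<close> by auto
    then show False using reach[of z v] assms by auto
  next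
    case False
    \<comment> \<open>Times before \<open>z\<close> are treated by reversing time, so that
      \<open>first_passage\<close> yields the last time before \<open>z\<close> at distance
      \<open>r\<close>.\<close>
    let ?k = "\<lambda>v. ?g (- v)"
    have "continuous_on {-z..-t} ?k"
      by (rule continuous_on_compose2[OF gcont]) (use assms in \<open>auto intro!: continuous_intros\<close>)
    then obtain v where v: "v \<in> {-z..-t}" "?k v = r" "\<And>w. w \<in> {-z..v} \<Longrightarrow> ?k w \<le> r"
      using first_passage[of "-z" "-t" ?k r] False far \<open>0 < r\<close> \<open>X z = c\<close> by auto
    have "?g w \<le> r" if "w \<in> {-v..z}" for w
      using v(3)[of "-w"] that by auto
    then show False using reach[of "-v" z] v(1,2) assms by (auto simp: abs_minus_commute)
  qed
qed

text \<open>Pushed down and then up, the path must cross the level \<open>c\<close>; as it moves slowly, it then lingers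
  near \<open>c\<close> for one whole time step.\<close>

lemma occupation:
  assumes "0 \<le> s" "0 < h"
    and push: "\<And>k. k < 2 * n \<Longrightarrow>
      (if k < n then - 1 else 1) * (W (s + real k * h + h) - W (s + real k * h)) \<ge> sqrt h"
    and osc: "\<And>k t. k < 2 * n \<Longrightarrow> t \<in> {s + real k * h..s + real k * h + h} \<Longrightarrow>
      \<bar>W t - W (s + real k * h)\<bar> \<le> \<eta>"
    and small: "D * h + 2 * \<sigma> * \<eta> < r" and room: "l < c - r" "c + r < u" "0 < r"
    and far: "u - l < real n * (\<sigma> * sqrt h - D * h)"
    and g: "continuous_on {l..u} g" "\<And>y. y \<in> {l..u} \<Longrightarrow> 0 \<le> g y" "\<And>y. \<bar>y - c\<bar> \<le> r \<Longrightarrow> e \<le> g y"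
  shows "e * h \<le> integral {s..s + real (2 * n) * h} (\<lambda>t. g (X t))"
proof -
  let ?m = "s + real n * h" and ?e = "s + real (2 * n) * h"
  have order: "s \<le> ?m" "?m \<le> ?e" using \<open>0 < h\<close> by (auto simp: algebra_simps)
  have down: "W (s + real k * h) - W s \<le> - (real k * sqrt h)" if "k \<le> n" for k
    using that
  proof (induction k)
    case (Suc k)
    then show ?case using push[of k] by (simp add: algebra_simps)
  qed simp
  have up: "W (?m + real k * h) - W ?m \<ge> real k * sqrt h" if "k \<le> n" for k
    using that
  proof (induction k)
    case (Suc k)
    then show ?case using push[of "n + k"] by (simp add: algebra_simps)
  qed simp
  have far': "u - l < \<sigma> * (real n * sqrt h) - D * (real n * h)" using far by (simp add: algebra_simps)
  obtain t1 where t1: "t1 \<in> {s..?m}" "X t1 \<le> c"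
    using push_down[of s ?m "real n * sqrt h" c] down[of n] far' room order \<open>0 \<le> s\<close> by auto
  have e_eq: "?m + real n * h = ?e" by (simp add: algebra_simps)
  obtain t2 where t2: "t2 \<in> {?m..?e}" "X t2 \<ge> c"
    using push_up[of ?m ?e "real n * sqrt h" c] up[of n] far' room order \<open>0 \<le> s\<close> e_eq
    by (auto simp: algebra_simps)
  \<comment> \<open>The low point lies before the middle of the block and the high point after it,
    so a crossing of \<open>c\<close> happens in between.\<close>
  have "\<exists>z. t1 \<le> z \<and> z \<le> t2 \<and> X z = c"
  proof (rule IVT')
    show "continuous_on {t1..t2} X"
      by (rule continuous_on_subset[OF X_cont]) (use t1 \<open>0 \<le> s\<close> in auto)
  qed (use t1 t2 in auto)
  then obtain z where z: "X z = c" "s \<le> z" "z \<le> ?e" using t1 t2 by force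
  have n: "0 < n" using far room by (cases n) auto
  \<comment> \<open>The step that contains \<open>z\<close>. At the right end of the block the floor
    would give the nonexistent step \<open>2 * n\<close>, so the last step is taken there.\<close>
  obtain k where k: "k < 2 * n" "z \<in> {s + real k * h..s + real k * h + h}"
  proof (cases "z = ?e")
    case True
    then have "z \<in> {s + real (2 * n - 1) * h..s + real (2 * n - 1) * h + h}"
      using n \<open>0 < h\<close> by (auto simp: algebra_simps of_nat_diff)
    then show ?thesis using n that[of "2 * n - 1"] by simp
  next
    case False
    define k where "k = nat \<lfloor>(z - s) / h\<rfloor>"
    have "0 \<le> (z - s) / h" using z \<open>0 < h\<close> by simp
    then have k: "real k \<le> (z - s) / h" "(z - s) / h < real k + 1"
      unfolding k_def by linarith+
    then have "real k * h \<le> z - s" "z - s < (real k + 1) * h"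
      using \<open>0 < h\<close> by (auto simp: field_simps)
    moreover have "k < 2 * n"
    proof -
      have "(z - s) / h < real (2 * n)" using z False \<open>0 < h\<close> by (simp add: field_simps)
      then show ?thesis using k(1) by linarith
    qed
    ultimately show ?thesis using that[of k] by (auto simp: algebra_simps)
  qed
  let ?a = "s + real k * h" and ?b = "s + real k * h + h"
  have "real k * h + h \<le> real (2 * n) * h"
    using k \<open>0 < h\<close> mult_right_mono[of "real (Suc k)" "real (2 * n)" h] by (simp add: algebra_simps)
  then have sub: "{?a..?b} \<subseteq> {s..?e}" and "0 \<le> ?a" using \<open>0 < h\<close> \<open>0 \<le> s\<close> by auto
  have near: "\<bar>X t - c\<bar> \<le> r" if "t \<in> {?a..?b}" for t
    using stays_near[OF \<open>0 \<le> ?a\<close> k(2) z(1) osc[OF k(1)] small room(1,2) that] by simp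
  have "e * h = integral {?a..?b} (\<lambda>t. e)" using \<open>0 < h\<close> by simp
  also have "\<dots> \<le> integral {?a..?b} (\<lambda>t. g (X t))"
    using near g \<open>0 \<le> ?a\<close> by (intro integral_le compose_integrable) auto
  also have "\<dots> \<le> integral {s..?e} (\<lambda>t. g (X t))"
    using sub g \<open>0 \<le> s\<close> \<open>0 \<le> ?a\<close> X_range by (intro integral_subset_le compose_integrable) auto
  finally show ?thesis .
qed

end

text \<open>Blocks in \<open>K\<close> contribute at least \<open>e\<close>, the others at least 0
  because \<open>g\<close> is nonnegative.\<close>

lemma (in reflected_path) occupation_blocks:
  fixes g :: "real \<Rightarrow> real"
  assumes g: "continuous_on {l..u} g" "\<And>y. y \<in> {l..u} \<Longrightarrow> 0 \<le> g y" and "0 \<le> d"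
    and hit: "\<And>k. k \<in> K \<Longrightarrow> e \<le> integral {real k * d..real k * d + d} (\<lambda>t. g (X t))"
  shows "e * real (card {k. k < n \<and> k \<in> K}) \<le> integral {0..real n * d} (\<lambda>t. g (X t))"
proof (induction n)
  case (Suc n)
  let ?I = "integral {real n * d..real n * d + d} (\<lambda>t. g (X t))"
  have "{k. k < Suc n \<and> k \<in> K} = {k. k < n \<and> k \<in> K} \<union> (if n \<in> K then {n} else {})"
    by (auto simp: less_Suc_eq)
  then have "real (card {k. k < Suc n \<and> k \<in> K}) =
      real (card {k. k < n \<and> k \<in> K}) + (if n \<in> K then 1 else 0)" by simp
  moreover have "(if n \<in> K then e else 0) \<le> ?I"
  proof (cases "n \<in> K")
    case False
    have "0 \<le> real n * d" using \<open>0 \<le> d\<close> by simp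
    have "0 \<le> ?I"
    proof (rule integral_nonneg)
      show "(\<lambda>t. g (X t)) integrable_on {real n * d..real n * d + d}"
        by (rule compose_integrable[OF g(1)]) fact
      fix t assume "t \<in> {real n * d..real n * d + d}"
      then have "0 \<le> t" using \<open>0 \<le> real n * d\<close> by (meson atLeastAtMost_iff order_trans)
      then show "0 \<le> g (X t)" by (intro g X_range)
    qed
    then show ?thesis using False by simp
  qed (use hit in simp)
  moreover have "integral {0..real n * d} (\<lambda>t. g (X t)) + ?I = integral {0..real n * d + d} (\<lambda>t. g (X t))"
    using \<open>0 \<le> d\<close> by (intro Henstock_Kurzweil_Integration.integral_combine compose_integrable[OF g(1)]) auto
  moreover have "real (Suc n) * d = real n * d + d" by (simp add: algebra_simps)
  ultimately show ?case
    using Suc by (auto simp: distrib_left split: if_splits)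
qed simp

section \<open>Linear growth of occupation integrals\<close>

context brownian_space
begin

lemma AE_reflected_path:
  assumes sde: "reflected_sde_solution M F W b \<sigma> l u x X L R"
    and "0 < \<sigma>" "continuous_on {l..u} b" "\<And>y. y \<in> {l..u} \<Longrightarrow> \<bar>b y\<bar> \<le> D"
  shows "AE \<omega> in M. reflected_path (\<lambda>t. X t \<omega>) (\<lambda>t. W t \<omega>) (\<lambda>t. L t \<omega>) (\<lambda>t. R t \<omega>) b \<sigma> l u x D"
proof -
  note paths = sde[unfolded reflected_sde_solution_def, THEN conjunct2, THEN conjunct2, THEN conjunct2]
  show ?thesis
    by (rule AE_mp[OF paths], intro AE_I2 impI, elim conjE, unfold_locales) (use assms(2-) in auto)
qed

text \<open>Used with the square of \<open>f\<close>; this is where the assumption that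
  \<open>f\<close> does not vanish identically enters.\<close>

lemma occupation_growth:
  fixes g :: "real \<Rightarrow> real"
  assumes sde: "reflected_sde_solution M F W b \<sigma> l u x X L R"
    and "0 < \<sigma>" "l < u" and b: "continuous_on {l..u} b"
    and g: "continuous_on {l..u} g" "\<And>y. y \<in> {l..u} \<Longrightarrow> 0 \<le> g y" "\<exists>y\<in>{l..u}. 0 < g y"
  shows "\<exists>\<kappa>>0. AE \<omega> in M. \<forall>\<^sub>F T in at_top. \<kappa> * T \<le> integral {0..T} (\<lambda>t. g (X t \<omega>))"
proof -
  have "compact (b ` {l..u})" by (intro compact_continuous_image b) simp
  then have "bounded (b ` {l..u})" by (rule compact_imp_bounded)
  then obtain D where "\<forall>y\<in>{l..u}. \<bar>b y\<bar> \<le> D"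
    by (auto simp: bounded_iff)
  then have D: "\<bar>b y\<bar> \<le> D" if "y \<in> {l..u}" for y using that by blast
  obtain y where y: "y \<in> {l..u}" "0 < g y" using g(3) by blast
  define e where "e = g y / 2"
  have "0 < e" using y by (simp add: e_def)
  \<comment> \<open>The point \<open>y\<close> may be an endpoint of \<open>{l..u}\<close>, where
    reflection acts. So \<open>c\<close> is the midpoint of the part of the interval within distance
    \<open>d\<close> of \<open>y\<close>, and \<open>r\<close> a quarter of its length, which leaves
    room on both sides.\<close>
  obtain c r where r: "0 < r" "l < c - r" "c + r < u"
    and near: "\<And>z. \<bar>z - c\<bar> \<le> r \<Longrightarrow> e \<le> g z"
  proof -
    obtain d where d: "0 < d" "\<And>z. z \<in> {l..u} \<Longrightarrow> dist z y < d \<Longrightarrow> dist (g z) (g y) < e"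
      using g(1) y \<open>0 < e\<close> unfolding continuous_on_iff by blast
    define lo where "lo = max l (y - d)"
    define hi where "hi = min u (y + d)"
    have "lo < hi" using y d(1) \<open>l < u\<close> by (auto simp: lo_def hi_def)
    have "e \<le> g z" if "\<bar>z - (lo + hi) / 2\<bar> \<le> (hi - lo) / 4" for z
    proof -
      have "z - (lo + hi) / 2 \<le> (hi - lo) / 4" "(lo + hi) / 2 - z \<le> (hi - lo) / 4"
        using that unfolding abs_le_iff by linarith+
      then have "lo < z" "z < hi" using \<open>lo < hi\<close> by (auto simp: field_simps)
      then have "z \<in> {l..u}" "dist z y < d" by (auto simp: lo_def hi_def dist_real_def)
      then have "\<bar>g z - g y\<bar> < g y / 2"
        using d(2) unfolding e_def dist_real_def by blast
      then show ?thesis unfolding e_def abs_less_iff by linarith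
    qed
    moreover have "0 < (hi - lo) / 4" "l < (lo + hi) / 2 - (hi - lo) / 4"
      "(lo + hi) / 2 + (hi - lo) / 4 < u"
      using \<open>lo < hi\<close> max.cobounded1[of l "y - d"] min.cobounded1[of u "y + d"]
      unfolding lo_def[symmetric] hi_def[symmetric] by (auto simp: field_simps)
    ultimately show ?thesis by (rule that[rotated 3]) 
  qed
  \<comment> \<open>The last two conditions hold for all small \<open>h\<close>: the push is of
    order \<open>sqrt h\<close> and dominates the drift, of order \<open>h\<close>, while the
    oscillation still tends to 0.\<close>
  obtain h where h: "0 < h" "D * h + 2 * \<sigma> * oscillation_level h < r" "0 < \<sigma> * sqrt h - D * h"
  proof -
    have "((\<lambda>h. D * h + 2 * \<sigma> * sqrt (2 * h / std_normal_tail)) \<longlongrightarrow>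
        D * 0 + 2 * \<sigma> * sqrt (2 * 0 / std_normal_tail)) (at_right 0)"
      using std_normal_tail_pos by (intro tendsto_intros) auto
    then have 1: "\<forall>\<^sub>F h in at_right 0. D * h + 2 * \<sigma> * sqrt (2 * h / std_normal_tail) < r"
      using \<open>0 < r\<close> by (intro order_tendstoD(2)) auto
    have "((\<lambda>h. \<sigma> - D * sqrt h) \<longlongrightarrow> \<sigma> - D * sqrt 0) (at_right 0)"
      by (intro tendsto_intros)
    then have 2: "\<forall>\<^sub>F h in at_right 0. 0 < \<sigma> - D * sqrt h"
      using \<open>0 < \<sigma>\<close> by (intro order_tendstoD(1)) auto
    have "\<forall>\<^sub>F h in at_right (0::real). 0 < h" by (rule eventually_at_right_less)
    with 1 2 have "\<forall>\<^sub>F h in at_right (0::real). 0 < h \<and> D * h + 2 * \<sigma> * oscillation_level h < r \<and>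
        0 < \<sigma> * sqrt h - D * h"
    proof eventually_elim
      case (elim h)
      then have "0 < sqrt h * (\<sigma> - D * sqrt h)" by simp
      also have "\<dots> = \<sigma> * sqrt h - D * (sqrt h * sqrt h)" by (simp add: algebra_simps)
      also have "sqrt h * sqrt h = h" using elim by simp
      finally show ?case using elim by (simp add: oscillation_level_def)
    qed
    then show ?thesis using that by (auto dest!: eventually_happens)
  qed
  \<comment> \<open>The number of steps after which the accumulated push exceeds the width of the
    interval; a block has \<open>m\<close> steps down and \<open>m\<close> steps up.\<close>
  obtain m where m: "u - l < real m * (\<sigma> * sqrt h - D * h)"
    using reals_Archimedean3[OF h(3)] by blast
  then have "m \<noteq> 0" using \<open>l < u\<close> by (intro notI) simp
  define d where "d = real (2 * m) * h"
  have "0 < d" using \<open>m \<noteq> 0\<close> \<open>0 < h\<close> by (simp add: d_def)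
  define a where "a k = (if k < m then - 1 else 1 :: real)" for k
  have abs_a: "\<bar>a k\<bar> = 1" for k by (simp add: a_def)
  obtain \<kappa> where "0 < \<kappa>" and freq: "AE \<omega> in M. \<forall>\<^sub>F n in sequentially.
      \<kappa> * real n \<le> real (card {k. k < n \<and> \<omega> \<in> push_sequence h a (2 * m) (real k * d)})"
    using frequent_push_sequences[of h a "2 * m", OF \<open>0 < h\<close> abs_a] unfolding d_def by blast
  have path: "AE \<omega> in M. reflected_path (\<lambda>t. X t \<omega>) (\<lambda>t. W t \<omega>) (\<lambda>t. L t \<omega>) (\<lambda>t. R t \<omega>) b \<sigma> l u x D"
    by (rule AE_reflected_path[OF sde \<open>0 < \<sigma>\<close> b D])
  \<comment> \<open>A good block has length \<open>d\<close> and contributes at least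
    \<open>e * h\<close>, and the share of good blocks is eventually at least
    \<open>\<kappa>\<close>. The factor 2 pays for the incomplete last block: from
    \<open>T = 2 * d\<close> on there are at least \<open>T / (2 * d)\<close> complete ones.\<close>
  have "AE \<omega> in M. \<forall>\<^sub>F T in at_top. (e * h * \<kappa> / (2 * d)) * T \<le> integral {0..T} (\<lambda>t. g (X t \<omega>))"
    using freq path W_continuous
  proof eventually_elim
    case (elim \<omega>)
    interpret reflected_path "\<lambda>t. X t \<omega>" "\<lambda>t. W t \<omega>" "\<lambda>t. L t \<omega>" "\<lambda>t. R t \<omega>" b \<sigma> l u x D
      by (rule elim)
    define K where "K = {k. \<omega> \<in> push_sequence h a (2 * m) (real k * d)}"
    have hit: "e * h \<le> integral {real k * d..real k * d + d} (\<lambda>t. g (X t \<omega>))" if "k \<in> K" for k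
    proof -
      have s: "0 \<le> real k * d" using \<open>0 < d\<close> by simp
      have push: "\<omega> \<in> push_event h (real k * d + real j * h) (a j)" if "j < 2 * m" for j
        using \<open>k \<in> K\<close> that by (simp add: K_def push_sequence_def)
      have s': "0 \<le> real k * d + real j * h" for j using s \<open>0 < h\<close> by simp
      have "e * h \<le> integral {real k * d..real k * d + real (2 * m) * h} (\<lambda>t. g (X t \<omega>))"
        using push_eventD(2)[OF push elim(3) s' \<open>0 < h\<close>]
          push_eventD(1)[OF push elim(3) s' \<open>0 < h\<close>]
        by (intro occupation[OF s h(1) _ _ h(2) r(2,3,1) m g(1,2) near]) (auto simp: a_def)
      then show ?thesis by (simp add: d_def)
    qed
    obtain N where N: "\<And>n. N \<le> n \<Longrightarrow> \<kappa> * real n \<le> real (card {k. k < n \<and> k \<in> K})"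
      using elim(1) unfolding K_def eventually_sequentially by auto
    show ?case
    proof (rule eventually_at_top_linorderI)
      fix T assume T: "max (2 * d) (real N * d) \<le> T"
      define n where "n = nat \<lfloor>T / d\<rfloor>"
      have "2 \<le> T / d" "real N \<le> T / d" using T \<open>0 < d\<close> by (auto simp: field_simps)
      then have n: "real n \<le> T / d" "T / d - 1 \<le> real n" "N \<le> n" "1 \<le> T / (2 * d)"
        unfolding n_def by (linarith, linarith, linarith, simp)
      have nT: "real n * d \<le> T" "0 \<le> real n * d" using n(1) \<open>0 < d\<close> by (auto simp: field_simps)
      have "(e * h * \<kappa> / (2 * d)) * T = e * h * (\<kappa> * (T / (2 * d)))" by simp
      also have "\<dots> \<le> e * h * (\<kappa> * real n)"
      proof (intro mult_left_mono)
        have "T / d = T / (2 * d) + T / (2 * d)" by simp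
        then show "T / (2 * d) \<le> real n" using n by linarith
      qed (use \<open>0 < e\<close> \<open>0 < h\<close> \<open>0 < \<kappa>\<close> in auto)
      also have "\<dots> \<le> e * h * real (card {k. k < n \<and> k \<in> K})"
        using N[OF n(3)] \<open>0 < e\<close> \<open>0 < h\<close> by (intro mult_left_mono) auto
      also have "\<dots> \<le> integral {0..real n * d} (\<lambda>t. g (X t \<omega>))"
        using \<open>0 < d\<close> by (intro occupation_blocks g hit) auto
      also have "\<dots> \<le> integral {0..T} (\<lambda>t. g (X t \<omega>))"
        using nT g X_range by (intro integral_subset_le compose_integrable) auto
      finally show "(e * h * \<kappa> / (2 * d)) * T \<le> integral {0..T} (\<lambda>t. g (X t \<omega>))" .
    qed
  qed
  moreover have "0 < e * h * \<kappa> / (2 * d)" using \<open>0 < e\<close> \<open>0 < h\<close> \<open>0 < \<kappa>\<close> \<open>0 < d\<close> by simp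
  ultimately show ?thesis by blast
qed

end

section \<open>Left-endpoint approximation of the stochastic integral\<close>

text \<open>Replacing one factor of the square by its left-endpoint value costs at most
  \<open>\<epsilon> * C\<close> per unit of time. The sum is the drift part, up to the factor
  \<open>\<theta>\<close>, of the sums that approximate \<open>J\<close>.\<close>

lemma left_endpoint_sum_error:
  fixes \<phi> :: "real \<Rightarrow> real"
  assumes cont: "continuous_on {0..} \<phi>" and bound: "\<And>s. 0 \<le> s \<Longrightarrow> \<bar>\<phi> s\<bar> \<le> C"
    and "0 < h" "0 \<le> t" "t \<le> real K * h" "0 \<le> \<epsilon>"
    and osc: "\<And>s r. s \<in> {0..t} \<Longrightarrow> r \<in> {0..t} \<Longrightarrow> \<bar>s - r\<bar> \<le> h \<Longrightarrow> \<bar>\<phi> s - \<phi> r\<bar> \<le> \<epsilon>"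
  shows "\<bar>(\<Sum>k<K. \<phi> (real k * h) * integral {min t (real k * h)..min t (real (Suc k) * h)} \<phi>)
    - integral {0..t} (\<lambda>s. (\<phi> s)\<^sup>2)\<bar> \<le> \<epsilon> * C * t"
proof -
  have int: "\<phi> integrable_on {p..q}" "(\<lambda>s. (\<phi> s)\<^sup>2) integrable_on {p..q}"
    "(\<lambda>s. a * \<phi> s) integrable_on {p..q}" if "0 \<le> p" for p q a
    using that by (auto intro!: integrable_continuous_interval continuous_intros continuous_on_subset[OF cont])
  define S where "S n = (\<Sum>k<n. \<phi> (real k * h) * integral {min t (real k * h)..min t (real (Suc k) * h)} \<phi>)" for n
  have "\<bar>S n - integral {0..min t (real n * h)} (\<lambda>s. (\<phi> s)\<^sup>2)\<bar> \<le> \<epsilon> * C * min t (real n * h)" for n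
  proof (induction n)
    case 0
    then show ?case using \<open>0 \<le> t\<close> by (simp add: S_def min_def)
  next
    case (Suc n)
    let ?p = "min t (real n * h)" and ?q = "min t (real (Suc n) * h)"
    have pq: "0 \<le> ?p" "?p \<le> ?q" "?q \<le> t" "?q - ?p \<le> h"
      using \<open>0 \<le> t\<close> \<open>0 < h\<close> by (auto simp: algebra_simps min_def)
    have "\<bar>\<phi> (real n * h) * integral {?p..?q} \<phi> - integral {?p..?q} (\<lambda>s. (\<phi> s)\<^sup>2)\<bar> \<le> \<epsilon> * C * (?q - ?p)"
    proof (cases "t \<le> real n * h")
      case True
      then have "?p = t" "?q = t" using \<open>0 < h\<close> by (auto simp: algebra_simps min_def)
      then show ?thesis by simp
    next
      case False
      then have p: "?p = real n * h" by simp
      have "\<phi> (real n * h) * integral {?p..?q} \<phi> - integral {?p..?q} (\<lambda>s. (\<phi> s)\<^sup>2)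
          = integral {?p..?q} (\<lambda>s. \<phi> ?p * \<phi> s - (\<phi> s)\<^sup>2)"
        using int[OF pq(1)] unfolding p by (subst Henstock_Kurzweil_Integration.integral_diff) auto
      also have "norm \<dots> \<le> integral {?p..?q} (\<lambda>s. \<epsilon> * C)"
      proof (rule integral_norm_bound_integral)
        show "(\<lambda>s. \<phi> ?p * \<phi> s - (\<phi> s)\<^sup>2) integrable_on {?p..?q}"
          using int[OF pq(1)] by (intro integrable_diff) auto
        fix s assume s: "s \<in> {?p..?q}"
        have "norm (\<phi> ?p * \<phi> s - (\<phi> s)\<^sup>2) = \<bar>\<phi> ?p - \<phi> s\<bar> * \<bar>\<phi> s\<bar>"
          by (simp add: power2_eq_square left_diff_distrib[symmetric] abs_mult)
        also have "\<dots> \<le> \<epsilon> * C"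
        proof (intro mult_mono osc bound \<open>0 \<le> \<epsilon>\<close>)
          show "0 \<le> s" using pq(1) s by (meson atLeastAtMost_iff order_trans)
          then show "s \<in> {0..t}" using s by auto
          show "?p \<in> {0..t}" using pq by auto
          show "\<bar>?p - s\<bar> \<le> h" using pq s by auto
        qed simp
        finally show "norm (\<phi> ?p * \<phi> s - (\<phi> s)\<^sup>2) \<le> \<epsilon> * C" .
      qed auto
      also have "\<dots> = \<epsilon> * C * (?q - ?p)" using pq(2) by (simp add: integral_const_real mult_ac)
      finally show ?thesis by (simp only: real_norm_def)
    qed
    moreover have "integral {0..?p} (\<lambda>s. (\<phi> s)\<^sup>2) + integral {?p..?q} (\<lambda>s. (\<phi> s)\<^sup>2) = integral {0..?q} (\<lambda>s. (\<phi> s)\<^sup>2)"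
      using pq int by (intro Henstock_Kurzweil_Integration.integral_combine) auto
    moreover have "S (Suc n) = S n + \<phi> (real n * h) * integral {?p..?q} \<phi>" by (simp add: S_def)
    moreover have "\<epsilon> * C * ?q = \<epsilon> * C * ?p + \<epsilon> * C * (?q - ?p)" by (simp add: algebra_simps)
    ultimately show ?case using Suc by linarith
  qed
  from this[of K] show ?thesis using \<open>t \<le> real K * h\<close> by (simp add: S_def min_def)
qed

text \<open>The value at time 0 is listed separately because the half-open cells omit it.\<close>

definition left_endpoint :: "(real \<Rightarrow> 'a \<Rightarrow> real) \<Rightarrow> real \<Rightarrow> nat \<Rightarrow> 'a simple" where
  "left_endpoint H h K =
     (H 0, map (\<lambda>k. (real k * h, real (Suc k) * h, H (real k * h))) [0..<K])"

lemma simple_integral_left_endpoint: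
  "simple_integral (left_endpoint H h K) Y t \<omega> =
     (\<Sum>k<K. H (real k * h) \<omega> * (Y (min t (real (Suc k) * h)) \<omega> - Y (min t (real k * h)) \<omega>))"
  by (simp add: simple_integral_def left_endpoint_def comp_def interv_sum_list_conv_sum_set_nat
      atLeast0LessThan del: of_nat_Suc)

lemma simple_eval_left_endpoint:
  assumes "0 < h" "0 \<le> t" "t \<le> real K * h"
  shows "\<exists>r\<in>{0..t}. t - r \<le> h \<and> simple_eval (left_endpoint H h K) t \<omega> = H r \<omega>"
proof -
  have eval: "simple_eval (left_endpoint H h K) t \<omega> = H 0 \<omega> * indicator {0} t +
      (\<Sum>k<K. H (real k * h) \<omega> * indicator {real k * h<..real (Suc k) * h} t)"
    by (simp add: simple_eval_def left_endpoint_def comp_def interv_sum_list_conv_sum_set_nat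
        atLeast0LessThan del: of_nat_Suc)
  show ?thesis
  proof (cases "t = 0")
    case True
    have "indicator {real k * h<..real (Suc k) * h} t = (0 :: real)" for k
      using True \<open>0 < h\<close> by (simp add: not_less)
    then have "simple_eval (left_endpoint H h K) t \<omega> = H 0 \<omega>"
      unfolding eval using True by simp
    then show ?thesis using True \<open>0 < h\<close> by auto
  next
    case False
    \<comment> \<open>Ceiling minus one and not floor, because the cells contain their right
      ends.\<close>
    define j where "j = nat (\<lceil>t / h\<rceil> - 1)"
    have "0 < t / h" using False assms by simp
    then have "1 \<le> \<lceil>t / h\<rceil>" by linarith
    then have j: "real j < t / h" "t / h \<le> real j + 1" unfolding j_def by linarith+
    have "t / h \<le> real K" using assms by (simp add: field_simps)
    then have "j < K" using j by linarith
    have ind: "indicator {real k * h<..real (Suc k) * h} t = (if k = j then 1 else 0 :: real)" for k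
    proof -
      have "t \<in> {real k * h<..real (Suc k) * h} \<longleftrightarrow> real k < t / h \<and> t / h \<le> real k + 1"
        using \<open>0 < h\<close> by (auto simp: field_simps)
      also have "\<dots> \<longleftrightarrow> k = j"
        using j by linarith
      finally show ?thesis by (simp add: indicator_def)
    qed
    have "simple_eval (left_endpoint H h K) t \<omega> = H (real j * h) \<omega>"
      unfolding eval ind using False \<open>j < K\<close> by (simp add: if_distrib[of "(*) _"] cong: if_cong)
    moreover have "real j * h \<in> {0..t}" "t - real j * h \<le> h"
      using j \<open>0 < h\<close> by (auto simp: field_simps)
    ultimately show ?thesis by blast
  qed
qed

section \<open>Oscillation of continuous paths over short time spans\<close>

context prob_space
begin

text \<open>Dyadic times make this a countable union; continuity extends its complement to all times.\<close>

definition oscillation :: "(real \<Rightarrow> 'a \<Rightarrow> real) \<Rightarrow> real \<Rightarrow> real \<Rightarrow> real \<Rightarrow> 'a set" where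
  "oscillation H T \<delta> \<epsilon> = {\<omega> \<in> space M. \<exists>m i j.
     real i / 2 ^ m \<le> T \<and> real j / 2 ^ m \<le> T \<and> \<bar>real i / 2 ^ m - real j / 2 ^ m\<bar> < \<delta> \<and>
     \<bar>H (real i / 2 ^ m) \<omega> - H (real j / 2 ^ m) \<omega>\<bar> > \<epsilon>}"

lemma oscillation_sets:
  assumes "\<And>t. 0 \<le> t \<Longrightarrow> H t \<in> borel_measurable M"
  shows "oscillation H T \<delta> \<epsilon> \<in> events"
proof -
  have [measurable]: "H (real i / 2 ^ m) \<in> borel_measurable M" for i m
    by (rule assms) simp
  show ?thesis unfolding oscillation_def by measurable
qed

lemma oscillationD:
  assumes "\<omega> \<in> space M" "\<omega> \<notin> oscillation H T \<delta> \<epsilon>" and cont: "continuous_on {0..} (\<lambda>t. H t \<omega>)"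
    and st: "s \<in> {0..T}" "t \<in> {0..T}" "\<bar>s - t\<bar> < \<delta>"
  shows "\<bar>H s \<omega> - H t \<omega>\<bar> \<le> \<epsilon>"
proof (rule ccontr)
  assume far: "\<not> ?thesis"
  define S where "S m = real (nat \<lfloor>s * 2 ^ m\<rfloor>) / 2 ^ m" for m :: nat
  define U where "U m = real (nat \<lfloor>t * 2 ^ m\<rfloor>) / 2 ^ m" for m :: nat
  have S: "S \<longlonglongrightarrow> s" "\<And>m. S m \<le> T" and U: "U \<longlonglongrightarrow> t" "\<And>m. U m \<le> T"
  proof -
    have "0 \<le> s" "s \<le> T" "0 \<le> t" "t \<le> T" using st by auto
    then show "S \<longlonglongrightarrow> s" "S m \<le> T" "U \<longlonglongrightarrow> t" "U m \<le> T" for m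
      using dyadic_floor_tendsto dyadic_floor_le[of s m] dyadic_floor_le[of t m]
      unfolding S_def U_def by (blast, linarith, blast, linarith)
  qed
  have "(\<lambda>m. \<bar>S m - U m\<bar>) \<longlonglongrightarrow> \<bar>s - t\<bar>"
    by (intro tendsto_intros S U)
  then have 1: "\<forall>\<^sub>F m in sequentially. \<bar>S m - U m\<bar> < \<delta>"
    using st by (intro order_tendstoD(2)) auto
  have "(\<lambda>m. H (S m) \<omega>) \<longlonglongrightarrow> H s \<omega>"
    by (rule continuous_on_tendsto_compose[OF cont S(1)]) (use st in \<open>simp_all add: S_def\<close>)
  moreover have "(\<lambda>m. H (U m) \<omega>) \<longlonglongrightarrow> H t \<omega>"
    by (rule continuous_on_tendsto_compose[OF cont U(1)]) (use st in \<open>simp_all add: U_def\<close>)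
  ultimately have "(\<lambda>m. \<bar>H (S m) \<omega> - H (U m) \<omega>\<bar>) \<longlonglongrightarrow> \<bar>H s \<omega> - H t \<omega>\<bar>"
    by (intro tendsto_intros)
  then have 2: "\<forall>\<^sub>F m in sequentially. \<bar>H (S m) \<omega> - H (U m) \<omega>\<bar> > \<epsilon>"
    using far by (intro order_tendstoD(1)) auto
  obtain m where "\<bar>S m - U m\<bar> < \<delta>" "\<bar>H (S m) \<omega> - H (U m) \<omega>\<bar> > \<epsilon>"
    using eventually_happens[OF eventually_conj[OF 1 2]] by auto
  then have "\<omega> \<in> oscillation H T \<delta> \<epsilon>"
    using S(2)[of m] U(2)[of m] \<open>\<omega> \<in> space M\<close> unfolding oscillation_def S_def U_def by blast
  then show False using assms(2) by blast
qed

text \<open>The events decrease along \<open>\<delta>\<close>, and a continuous path, being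
  uniformly continuous on \<open>{0..T}\<close>, belongs to only finitely many of them.\<close>

lemma oscillation_vanishes:
  assumes meas: "\<And>t. 0 \<le> t \<Longrightarrow> H t \<in> borel_measurable M"
    and cont: "AE \<omega> in M. continuous_on {0..} (\<lambda>t. H t \<omega>)"
    and \<delta>: "decseq \<delta>" "\<delta> \<longlonglongrightarrow> 0" and "0 < \<epsilon>"
  shows "(\<lambda>n. prob (oscillation H T (\<delta> n) \<epsilon>)) \<longlonglongrightarrow> 0"
proof -
  let ?O = "\<lambda>n. oscillation H T (\<delta> n) \<epsilon>"
  have ev: "?O n \<in> events" for n by (rule oscillation_sets[OF meas])
  have "?O n \<subseteq> ?O m" if "m \<le> n" for m n
    using decseqD[OF \<delta>(1) that] unfolding oscillation_def by (blast intro: order.strict_trans2)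
  then have "decseq ?O" by (auto simp: decseq_def)
  then have lim: "(\<lambda>n. prob (?O n)) \<longlonglongrightarrow> prob (\<Inter>n. ?O n)"
    using ev by (intro finite_Lim_measure_decseq) auto
  have "AE \<omega> in M. \<omega> \<notin> (\<Inter>n. ?O n)"
    using cont
  proof eventually_elim
    case (elim \<omega>)
    have "uniformly_continuous_on {0..T} (\<lambda>t. H t \<omega>)"
      by (intro compact_uniformly_continuous continuous_on_subset[OF elim]) auto
    then obtain d where d: "0 < d" "\<And>s t. s \<in> {0..T} \<Longrightarrow> t \<in> {0..T} \<Longrightarrow> \<bar>t - s\<bar> < d \<Longrightarrow> \<bar>H t \<omega> - H s \<omega>\<bar> < \<epsilon>"
      using \<open>0 < \<epsilon>\<close> unfolding uniformly_continuous_on_def dist_real_def by blast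
    obtain n where n: "\<delta> n < d"
      using eventually_happens[OF order_tendstoD(2)[OF \<delta>(2) d(1)]] by auto
    have "\<omega> \<notin> ?O n"
    proof
      assume "\<omega> \<in> ?O n"
      then obtain m i j where ij: "real i / 2 ^ m \<le> T" "real j / 2 ^ m \<le> T"
        "\<bar>real i / 2 ^ m - real j / 2 ^ m\<bar> < \<delta> n"
        "\<bar>H (real i / 2 ^ m) \<omega> - H (real j / 2 ^ m) \<omega>\<bar> > \<epsilon>"
        unfolding oscillation_def by blast
      then have "\<bar>H (real i / 2 ^ m) \<omega> - H (real j / 2 ^ m) \<omega>\<bar> < \<epsilon>"
        using n by (intro d(2)) auto
      then show False using ij(4) by simp
    qed
    then show ?case by blast
  qed
  then have "prob (\<Inter>n. ?O n) = 0"
    using ev by (subst prob_eq_0) auto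
  then show ?thesis using lim by simp
qed

end

text \<open>\<open>ucp\<close> asks for measurable covers, so almost sure properties are used
  through a measurable null set.\<close>

lemma (in prob_space) AE_covered:
  assumes "AE \<omega> in M. P \<omega>"
  obtains N where "N \<in> events" "prob N = 0" "\<And>\<omega>. \<omega> \<in> space M \<Longrightarrow> \<omega> \<notin> N \<Longrightarrow> P \<omega>"
  using assms by (elim AE_E) (auto simp: emeasure_eq_measure)

section \<open>Strong law for the martingale part of the stochastic integral\<close>

context brownian_space
begin

lemma step_integral_extend:
  assumes "t \<le> s + real K * h" "0 < h" "K \<le> K'"
  shows "step_integral s h K' \<xi> t \<omega> = step_integral s h K \<xi> t \<omega>"
  unfolding step_integral_def
proof (rule sum.mono_neutral_right)
  have "W (min t (s + real (Suc k) * h)) \<omega> - W (min t (s + real k * h)) \<omega> = 0" if "K \<le> k" for k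
  proof -
    have "real K * h \<le> real k * h" "real K * h \<le> real (Suc k) * h"
      using that \<open>0 < h\<close> by (intro mult_right_mono; simp)+
    then have "min t (s + real k * h) = t" "min t (s + real (Suc k) * h) = t"
      using assms(1) by linarith+
    then show ?thesis by (simp only: diff_self)
  qed
  then show "\<forall>k\<in>{..<K'} - {..<K}. \<xi> k \<omega> * (W (min t (s + real (Suc k) * h)) \<omega>
      - W (min t (s + real k * h)) \<omega>) = 0" by auto
qed (use assms in auto)

lemma ucpD:
  assumes "ucp M Z Y" "0 \<le> T" "0 < \<epsilon>"
  obtains A where "\<And>n. A n \<in> events" "(\<lambda>n. prob (A n)) \<longlonglongrightarrow> 0"
    "\<And>n \<omega> t. \<omega> \<in> space M \<Longrightarrow> \<omega> \<notin> A n \<Longrightarrow> t \<in> {0..T} \<Longrightarrow> \<bar>Z n t \<omega> - Y t \<omega>\<bar> \<le> \<epsilon>"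
proof -
  obtain A where A: "\<forall>n. A n \<in> events \<and> {\<omega> \<in> space M. \<exists>t\<in>{0..T}. \<bar>Z n t \<omega> - Y t \<omega>\<bar> > \<epsilon>} \<subseteq> A n"
    "(\<lambda>n. prob (A n)) \<longlonglongrightarrow> 0"
    using assms unfolding ucp_def by blast
  have "\<bar>Z n t \<omega> - Y t \<omega>\<bar> \<le> \<epsilon>" if "\<omega> \<in> space M" "\<omega> \<notin> A n" "t \<in> {0..T}" for n \<omega> t
  proof (rule ccontr)
    assume "\<not> ?thesis"
    then have "\<omega> \<in> {\<omega> \<in> space M. \<exists>t\<in>{0..T}. \<bar>Z n t \<omega> - Y t \<omega>\<bar> > \<epsilon>}"
      using that by (auto simp: not_le)
    then show False using A(1) that by blast
  qed
  then show ?thesis using A that by blast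
qed

context
  fixes H H' Y J :: "real \<Rightarrow> 'a \<Rightarrow> real" and C \<theta> \<sigma> y0 :: real
  assumes adapted: "adapted F H'"
    and bound: "\<And>t \<omega>. 0 \<le> t \<Longrightarrow> \<omega> \<in> space M \<Longrightarrow> \<bar>H' t \<omega>\<bar> \<le> C"
    and cont: "AE \<omega> in M. continuous_on {0..} (\<lambda>t. H' t \<omega>)"
    and modif: "AE \<omega> in M. \<forall>t\<ge>0. H t \<omega> = H' t \<omega>"
    and Y_eq: "AE \<omega> in M. \<forall>t\<ge>0. Y t \<omega> = y0 + \<theta> * integral {0..t} (\<lambda>s. H' s \<omega>) + \<sigma> * W t \<omega>"
    and \<sigma>_pos: "0 < \<sigma>"
    and J: "is_stochastic_integral M F H Y J"
begin

definition mesh :: "nat \<Rightarrow> real" where "mesh n = 1 / real (Suc n)"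

text \<open>The mesh shrinks while the horizon \<open>Suc n\<close> grows, so one sequence serves
  every compact time interval, and natural numbers are grid points. \<open>H'\<close> replaces
  \<open>H\<close> because simple processes must be adapted and bounded at every outcome.\<close>

definition approx :: "nat \<Rightarrow> 'a simple" where
  "approx n = left_endpoint H' (mesh n) (Suc n * Suc n)"

lemma mesh_pos: "0 < mesh n"
  by (simp add: mesh_def)

lemma mesh_end: "real (T * Suc n) * mesh n = real T"
proof -
  have "real (Suc n) \<noteq> 0" by simp
  then show ?thesis
    unfolding mesh_def of_nat_mult times_divide_eq_right mult_1_right by (rule nonzero_mult_div_cancel_right)
qed

lemma C_nonneg: "0 \<le> C"
proof -
  obtain \<omega> where "\<omega> \<in> space M" using not_empty by blast
  then show ?thesis using bound[of 0 \<omega>] by linarith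
qed

lemma H'_adapted: "0 \<le> s \<Longrightarrow> H' s \<in> borel_measurable (F s)"
  using adapted by (simp add: adapted_def)

lemma H'_measurable: "0 \<le> s \<Longrightarrow> H' s \<in> borel_measurable M"
  using H'_adapted measurable_filtration_M by blast

lemma approx_simple: "simple_process M F (approx n)"
proof -
  have "simple_process M F (left_endpoint H' h K)" if "0 < h" for h K
  proof -
    have "0 \<le> real k * h" "real k * h \<le> real (Suc k) * h" for k using that by auto
    moreover have "\<exists>C. \<forall>\<omega>\<in>space M. \<bar>H' t \<omega>\<bar> \<le> C" if "0 \<le> t" for t using bound[OF that] by blast
    ultimately show ?thesis
      using H'_adapted by (auto simp: simple_process_def left_endpoint_def simp del: of_nat_Suc)
  qed
  then show ?thesis unfolding approx_def using mesh_pos .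
qed

text \<open>\<open>oscillation\<close> bounds time differences strictly; the factor 2 admits
  differences up to and including the mesh.\<close>

lemma oscillation_mesh_vanishes:
  assumes "0 < \<epsilon>"
  shows "(\<lambda>n. prob (oscillation H' T (2 * mesh n) \<epsilon>)) \<longlonglongrightarrow> 0"
proof (rule oscillation_vanishes[OF H'_measurable cont _ _ assms])
  show "decseq (\<lambda>n. 2 * mesh n)"
    by (auto simp: decseq_def mesh_def intro!: divide_left_mono)
  have "(\<lambda>n. 2 * (1 / real (Suc n))) \<longlonglongrightarrow> 2 * 0"
    by (intro tendsto_mult tendsto_const LIMSEQ_Suc[OF lim_1_over_n])
  then show "(\<lambda>n. 2 * mesh n) \<longlonglongrightarrow> 0" by (simp add: mesh_def)
qed

text \<open>This makes \<open>approx\<close> eligible in the universal clause of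
  \<open>is_stochastic_integral\<close>, the only source of information about
  \<open>J\<close>.\<close>

lemma approx_ucp: "ucp M (\<lambda>n. simple_eval (approx n)) H"
  unfolding ucp_def
proof (intro allI impI)
  fix T \<epsilon> :: real assume "0 \<le> T" "0 < \<epsilon>"
  obtain N where N: "N \<in> events" "prob N = 0"
    "\<And>\<omega>. \<omega> \<in> space M \<Longrightarrow> \<omega> \<notin> N \<Longrightarrow> continuous_on {0..} (\<lambda>t. H' t \<omega>) \<and> (\<forall>t\<ge>0. H t \<omega> = H' t \<omega>)"
    using AE_covered[OF AE_conjI[OF cont modif]] by blast
  \<comment> \<open>While the grid ends before \<open>T\<close>, the whole space serves as cover;
    this concerns finitely many \<open>n\<close>.\<close>
  define A where "A n = (if real (Suc n) < T then space M else N \<union> oscillation H' T (2 * mesh n) \<epsilon>)" for n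
  have osc: "oscillation H' T (2 * mesh n) \<epsilon> \<in> events" for n
    by (rule oscillation_sets[OF H'_measurable])
  have ev: "A n \<in> events" for n using N(1) osc by (simp add: A_def)
  have "{\<omega> \<in> space M. \<exists>t\<in>{0..T}. \<epsilon> < \<bar>simple_eval (approx n) t \<omega> - H t \<omega>\<bar>} \<subseteq> A n" for n
  proof (rule subsetI, rule ccontr)
    fix \<omega> assume \<omega>: "\<omega> \<in> {\<omega> \<in> space M. \<exists>t\<in>{0..T}. \<epsilon> < \<bar>simple_eval (approx n) t \<omega> - H t \<omega>\<bar>}"
      and "\<omega> \<notin> A n"
    then have n: "T \<le> real (Suc n)" "\<omega> \<in> space M" "\<omega> \<notin> N" "\<omega> \<notin> oscillation H' T (2 * mesh n) \<epsilon>"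
      by (auto simp: A_def split: if_splits)
    obtain t where t: "t \<in> {0..T}" "\<epsilon> < \<bar>simple_eval (approx n) t \<omega> - H t \<omega>\<bar>" using \<omega> by blast
    have "t \<le> real (Suc n * Suc n) * mesh n" using t n unfolding mesh_end by simp
    then obtain r where r: "r \<in> {0..t}" "t - r \<le> mesh n" "simple_eval (approx n) t \<omega> = H' r \<omega>"
      using simple_eval_left_endpoint[OF mesh_pos, of t "Suc n * Suc n" n H' \<omega>] t
      unfolding approx_def by auto
    have "\<bar>H' r \<omega> - H' t \<omega>\<bar> \<le> \<epsilon>"
      using r t mesh_pos[of n] N(3)[OF n(2,3)] by (intro oscillationD[OF n(2,4)]) auto
    then show False using t r N(3)[OF n(2,3)] by auto
  qed
  moreover have "(\<lambda>n. prob (A n)) \<longlonglongrightarrow> 0"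
  proof (rule real_tendsto_sandwich[OF _ _ tendsto_const oscillation_mesh_vanishes[OF \<open>0 < \<epsilon>\<close>, of T]])
    show "\<forall>\<^sub>F n in sequentially. prob (A n) \<le> prob (oscillation H' T (2 * mesh n) \<epsilon>)"
    proof (rule eventually_sequentiallyI)
      fix n assume "nat \<lceil>T\<rceil> \<le> n"
      then have "\<not> real (Suc n) < T" by linarith
      then have "A n = N \<union> oscillation H' T (2 * mesh n) \<epsilon>" unfolding A_def by simp
      then show "prob (A n) \<le> prob (oscillation H' T (2 * mesh n) \<epsilon>)"
        using measure_Un_le[OF N(1) osc[of n]] N(2) by simp
    qed
  qed simp
  ultimately show "\<exists>A. (\<forall>n. A n \<in> events \<and>
      {\<omega> \<in> space M. \<exists>t\<in>{0..T}. \<epsilon> < \<bar>simple_eval (approx n) t \<omega> - H t \<omega>\<bar>} \<subseteq> A n) \<and>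
      (\<lambda>n. prob (A n)) \<longlonglongrightarrow> 0"
    using ev by blast
qed

lemma approx_integral_ucp: "ucp M (\<lambda>n. simple_integral (approx n) Y) J"
  using J approx_simple approx_ucp unfolding is_stochastic_integral_def by blast

text \<open>The three multiples of \<open>\<kappa>\<close> are the distance of \<open>J\<close> from
  the approximating sum, the Brownian part of that sum, and the error of its drift part. The second
  fails with a probability bounded by the maximal inequality at level
  \<open>\<kappa> / \<sigma>\<close>; the failure of the others becomes negligible for fine meshes
  and goes into \<open>\<delta>\<close>.\<close>

lemma martingale_part_bound:
  assumes "0 < T" "0 < \<kappa>" "0 < \<delta>"
  shows "\<exists>B\<in>events. prob B \<le> C\<^sup>2 * \<sigma>\<^sup>2 * real T / \<kappa>\<^sup>2 + \<delta> \<and>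
    (\<forall>\<omega>\<in>space M - B. \<forall>t\<in>{0..real T}. \<bar>J t \<omega> - \<theta> * integral {0..t} (\<lambda>s. (H' s \<omega>)\<^sup>2)\<bar> \<le> 3 * \<kappa>)"
proof -
  \<comment> \<open>Keeps the drift error within \<open>\<kappa>\<close>; the 1 in the denominator
    covers the case that \<open>\<theta>\<close> or \<open>C\<close> is 0.\<close>
  define \<epsilon> where "\<epsilon> = \<kappa> / (\<bar>\<theta>\<bar> * C * real T + 1)"
  have D: "0 \<le> \<bar>\<theta>\<bar> * C * real T" using C_nonneg by simp
  then have "0 < \<epsilon>" using \<open>0 < \<kappa>\<close> by (simp add: \<epsilon>_def)
  have \<epsilon>_le: "\<bar>\<theta>\<bar> * (\<epsilon> * C * real T) \<le> \<kappa>"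
  proof -
    have "\<bar>\<theta>\<bar> * (\<epsilon> * C * real T) = \<kappa> * (\<bar>\<theta>\<bar> * C * real T / (\<bar>\<theta>\<bar> * C * real T + 1))"
      by (simp add: \<epsilon>_def)
    also have "\<dots> \<le> \<kappa> * 1"
      using D \<open>0 < \<kappa>\<close> by (intro mult_left_mono) (auto simp: divide_le_eq_1)
    finally show ?thesis by simp
  qed
  obtain A where A: "\<And>n. A n \<in> events" "(\<lambda>n. prob (A n)) \<longlonglongrightarrow> 0"
    "\<And>n \<omega> t. \<omega> \<in> space M \<Longrightarrow> \<omega> \<notin> A n \<Longrightarrow> t \<in> {0..real T} \<Longrightarrow>
      \<bar>simple_integral (approx n) Y t \<omega> - J t \<omega>\<bar> \<le> \<kappa>"
    using ucpD[OF approx_integral_ucp, of "real T" \<kappa>] \<open>0 < \<kappa>\<close> by auto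
  obtain N where N: "N \<in> events" "prob N = 0"
    "\<And>\<omega>. \<omega> \<in> space M \<Longrightarrow> \<omega> \<notin> N \<Longrightarrow> continuous_on {0..} (\<lambda>t. H' t \<omega>) \<and>
      (\<forall>t\<ge>0. Y t \<omega> = y0 + \<theta> * integral {0..t} (\<lambda>s. H' s \<omega>) + \<sigma> * W t \<omega>) \<and>
      continuous_on {0..} (\<lambda>t. W t \<omega>)"
    using AE_covered[OF AE_conjI[OF cont AE_conjI[OF Y_eq W_continuous]]] by blast
  let ?O = "\<lambda>n. oscillation H' (real T) (2 * mesh n) \<epsilon>"
  have O: "?O n \<in> events" for n
    by (rule oscillation_sets[OF H'_measurable])
  have "(\<lambda>n. prob (A n) + prob (?O n)) \<longlonglongrightarrow> 0 + 0"
    by (intro tendsto_add A oscillation_mesh_vanishes[OF \<open>0 < \<epsilon>\<close>])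
  then have "\<forall>\<^sub>F n in sequentially. prob (A n) + prob (?O n) < \<delta>"
    using \<open>0 < \<delta>\<close> by (intro order_tendstoD(2)) auto
  then obtain n where n: "T \<le> n" "prob (A n) + prob (?O n) < \<delta>"
    using eventually_happens[OF eventually_conj[OF eventually_ge_at_top[of T]]] by force
  \<comment> \<open>\<open>?K\<close> cells fill exactly \<open>{0..T}\<close>, while
    \<open>approx n\<close> has \<open>?K'\<close> of them. The maximal inequality is applied to the
    former, as otherwise its bound would grow with \<open>n\<close>; since \<open>T \<le> n\<close>,
    both sums agree up to time \<open>T\<close>.\<close>
  let ?h = "mesh n" and ?K = "T * Suc n" and ?K' = "Suc n * Suc n"
  let ?\<xi> = "\<lambda>k. H' (real k * ?h)"
  have pos: "0 \<le> real k * ?h" for k using mesh_pos[of n] by simp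
  define Q where "Q = exceedance 0 ?h ?K ?\<xi> (\<kappa> / \<sigma>)"
  have Q_bound: "exceedance 0 ?h ?K ?\<xi> (\<kappa> / \<sigma>) \<in> sets (F (0 + real ?K * ?h))"
    "prob (exceedance 0 ?h ?K ?\<xi> (\<kappa> / \<sigma>)) \<le> ?h * (\<Sum>k<?K. \<integral>\<omega>. (?\<xi> k \<omega>)\<^sup>2 \<partial>M) / (\<kappa> / \<sigma>)\<^sup>2"
    using \<open>0 < \<kappa>\<close> \<sigma>_pos by (intro exceedance_bound[of _ _ _ _ _ C] mesh_pos bound pos; simp add: H'_adapted pos)+
  then have Q: "Q \<in> events"
    unfolding Q_def using sets_filtration_le[of "0 + real ?K * ?h"] pos[of ?K] by auto
  have "prob Q \<le> ?h * (\<Sum>k<?K. \<integral>\<omega>. (?\<xi> k \<omega>)\<^sup>2 \<partial>M) / (\<kappa> / \<sigma>)\<^sup>2"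
    unfolding Q_def by (rule Q_bound)
  also have "\<dots> \<le> ?h * (\<Sum>k<?K. C\<^sup>2) / (\<kappa> / \<sigma>)\<^sup>2"
  proof (intro divide_right_mono mult_left_mono sum_mono)
    fix k
    have "(\<integral>\<omega>. (?\<xi> k \<omega>)\<^sup>2 \<partial>M) \<le> (\<integral>\<omega>. C\<^sup>2 \<partial>M)"
    proof (rule integral_mono')
      show "(?\<xi> k \<omega>)\<^sup>2 \<le> C\<^sup>2" if "\<omega> \<in> space M" for \<omega>
        using bound[OF pos that] C_nonneg by (simp add: abs_le_square_iff[symmetric])
    qed auto
    then show "(\<integral>\<omega>. (?\<xi> k \<omega>)\<^sup>2 \<partial>M) \<le> C\<^sup>2" by (simp add: prob_space)
  qed (use mesh_pos[of n] in auto)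
  also have "\<dots> = (real ?K * ?h) * C\<^sup>2 / (\<kappa> / \<sigma>)\<^sup>2" by (simp only: sum_constant card_lessThan mult_ac)
  also have "\<dots> = C\<^sup>2 * \<sigma>\<^sup>2 * real T / \<kappa>\<^sup>2"
    unfolding mesh_end by (simp add: power_divide)
  finally have Qp: "prob Q \<le> C\<^sup>2 * \<sigma>\<^sup>2 * real T / \<kappa>\<^sup>2" .
  define B where "B = Q \<union> ((A n \<union> ?O n) \<union> N)"
  have "prob B \<le> prob Q + ((prob (A n) + prob (?O n)) + prob N)"
    unfolding B_def using Q A(1) O N(1)
    by (intro order_trans[OF measure_Un_le] add_mono order_refl) auto
  then have "prob B \<le> C\<^sup>2 * \<sigma>\<^sup>2 * real T / \<kappa>\<^sup>2 + \<delta>" using Qp n(2) N(2) by simp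
  moreover have "B \<in> events" unfolding B_def using Q A(1) O N(1) by auto
  moreover have "\<bar>J t \<omega> - \<theta> * integral {0..t} (\<lambda>s. (H' s \<omega>)\<^sup>2)\<bar> \<le> 3 * \<kappa>"
    if "\<omega> \<in> space M - B" and t: "t \<in> {0..real T}" for \<omega> t
  proof -
    have \<omega>: "\<omega> \<in> space M" "\<omega> \<notin> Q" "\<omega> \<notin> A n" "\<omega> \<notin> ?O n" "\<omega> \<notin> N"
      using that by (auto simp: B_def)
    have path: "continuous_on {0..} (\<lambda>t. H' t \<omega>)" "continuous_on {0..} (\<lambda>t. W t \<omega>)"
      "\<And>t. 0 \<le> t \<Longrightarrow> Y t \<omega> = y0 + \<theta> * integral {0..t} (\<lambda>s. H' s \<omega>) + \<sigma> * W t \<omega>"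
      using N(3)[OF \<omega>(1,5)] by auto
    define P where "P k = min t (real k * ?h)" for k
    have P: "0 \<le> P k" "P k \<le> P (Suc k)" for k
      using t pos[of k] pos[of "Suc k"] mesh_pos[of n] by (auto simp: P_def min_def algebra_simps)
    have Y_inc: "Y (P (Suc k)) \<omega> - Y (P k) \<omega> =
        \<theta> * integral {P k..P (Suc k)} (\<lambda>s. H' s \<omega>) + \<sigma> * (W (P (Suc k)) \<omega> - W (P k) \<omega>)" for k
    proof -
      have "integral {0..P k} (\<lambda>s. H' s \<omega>) + integral {P k..P (Suc k)} (\<lambda>s. H' s \<omega>)
          = integral {0..P (Suc k)} (\<lambda>s. H' s \<omega>)"
        using P[of k] by (intro Henstock_Kurzweil_Integration.integral_combine
          integrable_continuous_interval continuous_on_subset[OF path(1)]) auto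
      then show ?thesis
        unfolding path(3)[OF P(1)] by (simp add: right_diff_distrib distrib_left flip: \<open>_ = integral {0..P (Suc k)} _\<close>)
    qed
    define S where "S = (\<Sum>k<?K'. ?\<xi> k \<omega> * integral {P k..P (Suc k)} (\<lambda>s. H' s \<omega>))"
    have "simple_integral (approx n) Y t \<omega> = \<theta> * S + \<sigma> * step_integral 0 ?h ?K' ?\<xi> t \<omega>"
      unfolding approx_def simple_integral_left_endpoint step_integral_def S_def
        add_0_left P_def[symmetric] Y_inc sum_distrib_left sum.distrib[symmetric]
      by (intro sum.cong refl) (simp add: algebra_simps)
    moreover have "\<bar>\<sigma> * step_integral 0 ?h ?K' ?\<xi> t \<omega>\<bar> \<le> \<kappa>"
    proof -
      have "\<bar>step_integral 0 ?h ?K ?\<xi> t \<omega>\<bar> \<le> \<kappa> / \<sigma>"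
      proof (rule ccontr)
        assume "\<not> ?thesis"
        then have "\<omega> \<in> Q"
          unfolding Q_def using t mesh_end[of T n]
          by (intro exceedanceI[OF \<omega>(1) path(2), where t=t] mesh_pos) auto
        then show False using \<omega>(2) by simp
      qed
      moreover have "step_integral 0 ?h ?K' ?\<xi> t \<omega> = step_integral 0 ?h ?K ?\<xi> t \<omega>"
        using t n(1) mesh_end[of T n] by (intro step_integral_extend mesh_pos mult_le_mono1) auto
      ultimately show ?thesis
        using \<sigma>_pos by (simp add: abs_mult field_simps)
    qed
    moreover have "\<bar>\<theta> * S - \<theta> * integral {0..t} (\<lambda>s. (H' s \<omega>)\<^sup>2)\<bar> \<le> \<kappa>"
    proof -
      have end': "t \<le> real ?K' * ?h" unfolding mesh_end using t n(1) by simp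
      have osc: "\<bar>H' s \<omega> - H' r \<omega>\<bar> \<le> \<epsilon>" if "s \<in> {0..t}" "r \<in> {0..t}" "\<bar>s - r\<bar> \<le> ?h" for s r
        using that t mesh_pos[of n] by (intro oscillationD[OF \<omega>(1,4) path(1)]) auto
      have "\<bar>S - integral {0..t} (\<lambda>s. (H' s \<omega>)\<^sup>2)\<bar> \<le> \<epsilon> * C * t"
        unfolding S_def P_def
        using t \<open>0 < \<epsilon>\<close> by (intro left_endpoint_sum_error path(1) bound[OF _ \<omega>(1)] mesh_pos end' osc) auto
      also have "\<dots> \<le> \<epsilon> * C * real T"
        using t \<open>0 < \<epsilon>\<close> C_nonneg by (intro mult_left_mono) auto
      finally have "\<bar>\<theta>\<bar> * \<bar>S - integral {0..t} (\<lambda>s. (H' s \<omega>)\<^sup>2)\<bar> \<le> \<bar>\<theta>\<bar> * (\<epsilon> * C * real T)"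
        by (intro mult_left_mono) auto
      then show ?thesis using \<epsilon>_le by (simp add: abs_mult[symmetric] right_diff_distrib)
    qed
    ultimately show ?thesis using A(3)[OF \<omega>(1,3) t] by linarith
  qed
  ultimately show ?thesis by blast
qed

lemma martingale_part_eventually:
  assumes "0 < \<epsilon>"
  shows "AE \<omega> in M. \<forall>\<^sub>F T in at_top. \<bar>J T \<omega> - \<theta> * integral {0..T} (\<lambda>s. (H' s \<omega>)\<^sup>2)\<bar> \<le> \<epsilon> * T"
proof -
  \<comment> \<open>Of the 6, a factor 3 makes up for the three errors and a factor 2 for passing
    from \<open>T\<close> to the next power of 2. The horizon 2^j over the square of
    \<open>\<kappa> j\<close> leaves a multiple of 2^(-j), which is summable.\<close>
  define \<kappa> where "\<kappa> j = \<epsilon> / 6 * 2 ^ j" for j :: nat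
  have "\<exists>B\<in>events. prob B \<le> C\<^sup>2 * \<sigma>\<^sup>2 * real (2 ^ j) / (\<kappa> j)\<^sup>2 + (1 / 2) ^ j \<and>
    (\<forall>\<omega>\<in>space M - B. \<forall>t\<in>{0..real (2 ^ j)}.
      \<bar>J t \<omega> - \<theta> * integral {0..t} (\<lambda>s. (H' s \<omega>)\<^sup>2)\<bar> \<le> 3 * \<kappa> j)" for j
    using assms by (intro martingale_part_bound) (auto simp: \<kappa>_def)
  then obtain B where B: "\<And>j. B j \<in> events"
    "\<And>j. prob (B j) \<le> C\<^sup>2 * \<sigma>\<^sup>2 * real (2 ^ j) / (\<kappa> j)\<^sup>2 + (1 / 2) ^ j"
    "\<And>j \<omega> t. \<omega> \<in> space M - B j \<Longrightarrow> t \<in> {0..real (2 ^ j)} \<Longrightarrow>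
      \<bar>J t \<omega> - \<theta> * integral {0..t} (\<lambda>s. (H' s \<omega>)\<^sup>2)\<bar> \<le> 3 * \<kappa> j"
    by metis
  have B2: "prob (B j) \<le> (C\<^sup>2 * \<sigma>\<^sup>2 / (\<epsilon> / 6)\<^sup>2 + 1) * (1 / 2) ^ j" for j
  proof -
    have "C\<^sup>2 * \<sigma>\<^sup>2 * real (2 ^ j) / (\<kappa> j)\<^sup>2 = C\<^sup>2 * \<sigma>\<^sup>2 / (\<epsilon> / 6)\<^sup>2 * (1 / 2) ^ j"
      using assms by (simp add: \<kappa>_def power_mult_distrib power2_eq_square power_one_over field_simps)
    then show ?thesis using B(2)[of j] by (simp add: distrib_right)
  qed
  have "AE \<omega> in M. \<forall>\<^sub>F j in sequentially. \<omega> \<in> space M - B j"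
  proof (rule borel_cantelli_AE1[OF B(1)])
    show "summable (\<lambda>j. prob (B j))"
      using B2 by (intro summable_comparison_test'[OF summable_mult[OF summable_geometric[of "1 / 2"]], of 0]) auto
  qed (simp add: emeasure_eq_measure)
  then show ?thesis
  proof eventually_elim
    case (elim \<omega>)
    then obtain j0 where j0: "\<And>j. j0 \<le> j \<Longrightarrow> \<omega> \<in> space M - B j"
      unfolding eventually_sequentially by blast
    show ?case
    proof (rule eventually_at_top_linorderI)
      fix T :: real assume T: "2 ^ j0 \<le> T"
      have "1 \<le> T" using T one_le_power[of "2 :: real" j0] by linarith
      obtain j where j: "2 ^ j \<le> T" "T \<le> 2 ^ Suc j" "j0 \<le> j"
      proof -
        define j where "j = nat \<lfloor>log 2 T\<rfloor>"
        have "0 \<le> log 2 T" using \<open>1 \<le> T\<close> by simp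
        then have "real j \<le> log 2 T" "log 2 T \<le> real (Suc j)" "j0 \<le> j"
          using T \<open>1 \<le> T\<close> le_log_of_power[of 2 j0 T] unfolding j_def by (linarith | simp add: le_nat_iff le_floor_iff)+
        then show ?thesis
          using that[of j] \<open>1 \<le> T\<close> by (simp add: le_log_iff log_le_iff powr_realpow del: power_Suc of_nat_Suc)
      qed
      have "\<bar>J T \<omega> - \<theta> * integral {0..T} (\<lambda>s. (H' s \<omega>)\<^sup>2)\<bar> \<le> 3 * \<kappa> (Suc j)"
        using j \<open>1 \<le> T\<close> by (intro B(3) j0) auto
      also have "\<dots> = \<epsilon> * 2 ^ j" by (simp add: \<kappa>_def)
      also have "\<dots> \<le> \<epsilon> * T" using j assms by (intro mult_left_mono) auto
      finally show "\<bar>J T \<omega> - \<theta> * integral {0..T} (\<lambda>s. (H' s \<omega>)\<^sup>2)\<bar> \<le> \<epsilon> * T" .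
    qed
  qed
qed

lemma martingale_part_lln:
  "AE \<omega> in M. ((\<lambda>T. (J T \<omega> - \<theta> * integral {0..T} (\<lambda>s. (H' s \<omega>)\<^sup>2)) / T) \<longlongrightarrow> 0) at_top"
proof -
  have "AE \<omega> in M. \<forall>i. \<forall>\<^sub>F T in at_top.
      \<bar>J T \<omega> - \<theta> * integral {0..T} (\<lambda>s. (H' s \<omega>)\<^sup>2)\<bar> \<le> 1 / real (Suc i) * T"
    by (intro AE_all_countable[THEN iffD2] allI martingale_part_eventually) simp
  then show ?thesis
  proof eventually_elim
    case (elim \<omega>)
    show ?case
    proof (rule tendstoI)
      fix e :: real assume "0 < e"
      then obtain i where i: "1 / real (Suc i) < e" using nat_approx_posE by blast
      have "\<forall>\<^sub>F T in at_top. \<bar>J T \<omega> - \<theta> * integral {0..T} (\<lambda>s. (H' s \<omega>)\<^sup>2)\<bar> \<le> 1 / real (Suc i) * T"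
        using elim by blast
      then show "\<forall>\<^sub>F T in at_top. dist ((J T \<omega> - \<theta> * integral {0..T} (\<lambda>s. (H' s \<omega>)\<^sup>2)) / T) 0 < e"
        using eventually_gt_at_top[of 0]
      proof eventually_elim
        case (elim T)
        then have "\<bar>J T \<omega> - \<theta> * integral {0..T} (\<lambda>s. (H' s \<omega>)\<^sup>2)\<bar> / T \<le> 1 / real (Suc i)"
          by (simp add: divide_le_eq)
        then show ?case using i elim by (simp add: dist_real_def)
      qed
    qed
  qed
qed

end

end

section \<open>Consistency\<close>

text \<open>Completing the square exhibits a concave parabola with vertex
  \<open>J T \<omega> / A\<close>; a feasible vertex is the only maximizer.\<close>

lemma log_likelihood_arg_max:
  assumes max: "is_arg_max (log_likelihood f \<sigma> X J T \<omega>) (\<lambda>\<theta>. \<bar>\<theta> - \<theta>0\<bar> \<le> \<rho>) \<theta>"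
    and A: "A = integral {0..T} (\<lambda>t. (f (X t \<omega>))\<^sup>2)" "0 < A" and "0 < T" "0 < \<sigma>"
    and feasible: "\<bar>J T \<omega> / A - \<theta>0\<bar> \<le> \<rho>"
  shows "\<theta> = J T \<omega> / A"
proof (rule ccontr)
  let ?m = "J T \<omega> / A"
  have eq: "log_likelihood f \<sigma> X J T \<omega> \<theta> = A / (2 * \<sigma>\<^sup>2 * T) * (?m\<^sup>2 - (\<theta> - ?m)\<^sup>2)" for \<theta>
    unfolding log_likelihood_def A(1)[symmetric]
    using assms(3-5) by (simp add: field_simps power2_eq_square)
  assume "\<theta> \<noteq> ?m"
  then have "0 < (\<theta> - ?m)\<^sup>2" by simp
  then have "A / (2 * \<sigma>\<^sup>2 * T) * (?m\<^sup>2 - (\<theta> - ?m)\<^sup>2) < A / (2 * \<sigma>\<^sup>2 * T) * (?m\<^sup>2 - (?m - ?m)\<^sup>2)"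
    using assms(3-5) by (intro mult_strict_left_mono) auto
  then have "log_likelihood f \<sigma> X J T \<omega> \<theta> < log_likelihood f \<sigma> X J T \<omega> ?m"
    unfolding eq .
  then show False using max feasible unfolding is_arg_max_def by blast
qed

theorem theorem3:
  fixes M :: "'a measure" and F :: "real \<Rightarrow> 'a measure"
    and W X L R J :: "real \<Rightarrow> 'a \<Rightarrow> real"
    and f :: "real \<Rightarrow> real" and l u \<sigma> x \<theta>0 \<rho> :: real
    and mle :: "real \<Rightarrow> 'a \<Rightarrow> real"
  assumes "filtered_prob_space M F"
    and "brownian_motion M F W"
    and "0 \<le> l" and "l < u" and "\<sigma> > 0" and "x \<in> {l..u}" and "\<rho> > 0"
    and "\<exists>C. C-lipschitz_on {l..u} f"
    and "\<exists>y\<in>{l..u}. f y \<noteq> 0"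
    and "reflected_sde_solution M F W (\<lambda>y. \<theta>0 * f y) \<sigma> l u x X L R"
    and "is_stochastic_integral M F (\<lambda>t \<omega>. f (X t \<omega>)) (\<lambda>t \<omega>. X t \<omega> - L t \<omega> + R t \<omega>) J"
    and "AE \<omega> in M. \<forall>T>0.
           is_arg_max (log_likelihood f \<sigma> X J T \<omega>) (\<lambda>\<theta>. \<bar>\<theta> - \<theta>0\<bar> \<le> \<rho>) (mle T \<omega>)"
  shows "AE \<omega> in M. ((\<lambda>T. mle T \<omega>) \<longlongrightarrow> \<theta>0) at_top"
proof -
  interpret brownian_space M F W
    using assms(1,2) by (simp add: brownian_space_def brownian_space_axioms_def)
  have f: "continuous_on {l..u} f"
    using assms(8) lipschitz_on_continuous_on by blast
  note sde = assms(10)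
  have "bounded (f ` {l..u})"
    by (intro compact_imp_bounded compact_continuous_image f) simp
  then obtain C where "\<forall>y\<in>{l..u}. \<bar>f y\<bar> \<le> C"
    by (auto simp: bounded_iff)
  then have C: "\<bar>f y\<bar> \<le> C" if "y \<in> {l..u}" for y using that by blast
  let ?clamp = "\<lambda>y. min u (max l y)"
  have clamp: "?clamp y \<in> {l..u}" for y using \<open>l < u\<close> by auto
  have clamp_id: "?clamp y = y" if "y \<in> {l..u}" for y using that by auto
  \<comment> \<open>\<open>X\<close> lies in \<open>{l..u}\<close> only almost surely, and
    \<open>f\<close> is controlled only there. Clamping yields a version of the integrand that is
    adapted and bounded at every outcome.\<close>
  define H where "H t \<omega> = f (?clamp (X t \<omega>))" for t \<omega>
  have fc_cont: "continuous_on UNIV (\<lambda>y. f (?clamp y))"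
    using clamp by (intro continuous_on_compose2[OF f] continuous_intros) auto
  have H_adapted: "adapted F H"
    unfolding adapted_def
  proof (intro allI impI)
    fix t :: real assume "0 \<le> t"
    then have "X t \<in> borel_measurable (F t)"
      using sde by (simp add: reflected_sde_solution_def adapted_def)
    then show "H t \<in> borel_measurable (F t)"
      unfolding H_def by (rule measurable_compose[OF _ borel_measurable_continuous_onI[OF fc_cont]])
  qed
  have H_bound: "\<bar>H t \<omega>\<bar> \<le> C" for t \<omega>
    unfolding H_def by (rule C[OF clamp])
  have drift: "continuous_on {l..u} (\<lambda>y. \<theta>0 * f y)" by (intro continuous_intros f)
  have drift_bound: "\<bar>\<theta>0 * f y\<bar> \<le> \<bar>\<theta>0\<bar> * C" if "y \<in> {l..u}" for y
    using C[OF that] by (simp add: abs_mult mult_left_mono)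
  have path: "AE \<omega> in M. reflected_path (\<lambda>t. X t \<omega>) (\<lambda>t. W t \<omega>) (\<lambda>t. L t \<omega>) (\<lambda>t. R t \<omega>)
      (\<lambda>y. \<theta>0 * f y) \<sigma> l u x (\<bar>\<theta>0\<bar> * C)"
    by (rule AE_reflected_path[OF sde \<open>\<sigma> > 0\<close> drift drift_bound])
  then have modif: "AE \<omega> in M. \<forall>t\<ge>0. f (X t \<omega>) = H t \<omega>"
  proof eventually_elim
    case (elim \<omega>)
    show ?case using reflected_path.X_range[OF elim] by (simp add: H_def clamp_id)
  qed
  have H_cont: "AE \<omega> in M. continuous_on {0..} (\<lambda>t. H t \<omega>)"
    using path
  proof eventually_elim
    case (elim \<omega>)
    show ?case
      unfolding H_def
      by (rule continuous_on_compose2[OF fc_cont reflected_path.X_cont[OF elim]]) simp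
  qed
  have Y_eq: "AE \<omega> in M. \<forall>t\<ge>0. X t \<omega> - L t \<omega> + R t \<omega>
      = x + \<theta>0 * integral {0..t} (\<lambda>s. H s \<omega>) + \<sigma> * W t \<omega>"
    using path modif
  proof eventually_elim
    case (elim \<omega>)
    have "integral {0..t} (\<lambda>s. f (X s \<omega>)) = integral {0..t} (\<lambda>s. H s \<omega>)" for t
      using elim(2) by (intro integral_cong) simp
    then show ?case using reflected_path.X_eq[OF elim(1)] by simp
  qed
  have lln: "AE \<omega> in M. ((\<lambda>T. (J T \<omega> - \<theta>0 * integral {0..T} (\<lambda>s. (H s \<omega>)\<^sup>2)) / T) \<longlongrightarrow> 0) at_top"
    by (rule martingale_part_lln[OF H_adapted H_bound H_cont modif Y_eq \<open>\<sigma> > 0\<close> assms(11)])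
  have "\<exists>\<kappa>>0. AE \<omega> in M. \<forall>\<^sub>F T in at_top. \<kappa> * T \<le> integral {0..T} (\<lambda>t. (f (X t \<omega>))\<^sup>2)"
    using assms(9) by (intro occupation_growth[OF sde \<open>\<sigma> > 0\<close> \<open>l < u\<close> drift] continuous_intros f) auto
  then obtain \<kappa> where "0 < \<kappa>"
    and growth: "AE \<omega> in M. \<forall>\<^sub>F T in at_top. \<kappa> * T \<le> integral {0..T} (\<lambda>t. (f (X t \<omega>))\<^sup>2)"
    by blast
  show ?thesis
    using lln growth modif assms(12)
  proof eventually_elim
    case (elim \<omega>)
    define A where "A T = integral {0..T} (\<lambda>t. (f (X t \<omega>))\<^sup>2)" for T
    define N where "N T = (J T \<omega> - \<theta>0 * A T) / T" for T
    have "integral {0..T} (\<lambda>s. (H s \<omega>)\<^sup>2) = A T" for T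
      unfolding A_def using elim(3) by (intro integral_cong) simp
    then have N: "(N \<longlongrightarrow> 0) at_top" using elim(1) unfolding N_def by simp
    have A_pos: "\<forall>\<^sub>F T in at_top. 0 < T \<and> \<kappa> * T \<le> A T \<and> 0 < A T"
      using elim(2) eventually_gt_at_top[of 0]
    proof eventually_elim
      case (elim T)
      then have "0 < \<kappa> * T" using \<open>0 < \<kappa>\<close> by simp
      then show ?case using elim unfolding A_def by auto
    qed
    \<comment> \<open>The error is \<open>N T\<close> times \<open>T / A T\<close>, and linear
      growth bounds the second factor by \<open>1 / \<kappa>\<close>.\<close>
    have "((\<lambda>T. J T \<omega> / A T - \<theta>0) \<longlongrightarrow> 0) at_top"
    proof (rule Lim_null_comparison)
      have "((\<lambda>T. \<bar>N T\<bar> / \<kappa>) \<longlongrightarrow> \<bar>0\<bar> / \<kappa>) at_top"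
        using \<open>0 < \<kappa>\<close> by (intro tendsto_intros N) auto
      then show "((\<lambda>T. \<bar>N T\<bar> / \<kappa>) \<longlongrightarrow> 0) at_top" by simp
      show "\<forall>\<^sub>F T in at_top. norm (J T \<omega> / A T - \<theta>0) \<le> \<bar>N T\<bar> / \<kappa>"
        using A_pos
      proof eventually_elim
        case (elim T)
        have "J T \<omega> / A T - \<theta>0 = N T * T / A T"
          using elim by (simp add: N_def field_simps)
        then have "norm (J T \<omega> / A T - \<theta>0) = \<bar>N T\<bar> * T / A T"
          using elim by (simp add: abs_mult)
        also have "\<dots> \<le> \<bar>N T\<bar> * T / (\<kappa> * T)"
          using elim \<open>0 < \<kappa>\<close> by (intro divide_left_mono) auto
        finally show ?case using elim by simp
      qed
    qed
    then have lim: "((\<lambda>T. J T \<omega> / A T) \<longlongrightarrow> \<theta>0) at_top"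
      by (simp add: LIM_zero_iff)
    \<comment> \<open>As \<open>\<rho>\<close> is positive, the vertex is eventually feasible, and
      from then on the constrained estimator coincides with it.\<close>
    have "\<forall>\<^sub>F T in at_top. dist (J T \<omega> / A T) \<theta>0 < \<rho>"
      by (rule tendstoD[OF lim \<open>\<rho> > 0\<close>])
    with A_pos have "\<forall>\<^sub>F T in at_top. J T \<omega> / A T = mle T \<omega>"
    proof eventually_elim
      case (elim T)
      have "is_arg_max (log_likelihood f \<sigma> X J T \<omega>) (\<lambda>\<theta>. \<bar>\<theta> - \<theta>0\<bar> \<le> \<rho>) (mle T \<omega>)"
        using \<open>\<forall>T>0. is_arg_max _ _ _\<close> elim(1) by blast
      then show ?case
        using elim \<open>\<sigma> > 0\<close> log_likelihood_arg_max[of f \<sigma> X J T \<omega> \<theta>0 \<rho> "mle T \<omega>" "A T"]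
        by (simp add: A_def dist_real_def)
    qed
    with lim show ?case by (rule Lim_transform_eventually)
  qed
qed

end
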